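(* Let $A$ be a finite dimensional complex, associative and commutative algebra with unit, let $\mathfrak{J}$ be its Jacobson radical, and let $S$ be a semisimple subalgebra of $A$ given by the Wedderburn–Malcev theorem, so that $A = S\oplus\mathfrak{J}$ as a vector space. Let $\mathfrak{g}$ be a finite dimensional complex Lie algebra whose center $\mathfrak{z}(\mathfrak{g})$ is contained in $[\mathfrak{g},\mathfrak{g}]$. Let $\operatorname{Der}(\mathfrak{g}) = \mathfrak{s}\ltimes\mathfrak{r}$ be a Levi decomposition of the derivation algebra of $\mathfrak{g}$, where $\mathfrak{r}$ is the solvable radical of $\operatorname{Der}(\mathfrak{g})$ and $\mathfrak{s}$ is a semisimple subalgebra (a Levi complement of $\mathfrak{r}$). If $\operatorname{Der}(A)$ is a solvable Lie algebra, then the radical $\widetilde{\mathfrak{r}}$ of the Lie algebra $\operatorname{Der}(\mathfrak{g}\otimes A)$ is $$\widetilde{\mathfrak{r}} = (\mathfrak{s}\otimes\mathfrak{J}) + (\mathfrak{r}\otimes A) + \big(\operatorname{Hom}_{\mathfrak{g}}(\mathfrak{g},\mathfrak{g})\otimes\operatorname{Der}(A)\big) + \operatorname{Hom}(\mathfrak{g}/[\mathfrak{g},\mathfrak{g}],\mathfrak{z}(\mathfrak{g}))\otimes\operatorname{End}(A),$$ and $\mathfrak{s}\otimes S$ is a semisimple Lie subalgebra of $\operatorname{Der}(\mathfrak{g}\otimes A)$.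
   Context: The current Lie algebra $\mathfrak{g}_A=\mathfrak{g}\otimes_{\mathbb{C}} A$ has bracket $[X_1\otimes a_1, X_2\otimes a_2] = [X_1,X_2]\otimes a_1a_2$. $\operatorname{Der}(\cdot)$ denotes the Lie algebra of derivations (of a Lie algebra or of an associative algebra) under the commutator bracket. $\operatorname{Hom}_{\mathfrak{g}}(\mathfrak{g},\mathfrak{g}) = \{T\in\operatorname{End}_{\mathbb C}(\mathfrak{g}) : \mathrm{ad}_x\circ T = T\circ \mathrm{ad}_x \text{ for all } x\in\mathfrak{g}\}$ is the centroid of $\mathfrak{g}$. $\operatorname{Hom}(\mathfrak{g}/[\mathfrak{g},\mathfrak{g}],\mathfrak{z}(\mathfrak{g}))$ is the space of linear maps, regarded as linear maps $\mathfrak{g}\to\mathfrak{g}$ vanishing on $[\mathfrak{g},\mathfrak{g}]$ with image in $\mathfrak{z}(\mathfrak{g})$. $\operatorname{End}(A)$ is the space of all $\mathbb{C}$-linear endomorphisms of $A$. An element $a\in A$ is identified with the multiplication map $b\mapsto ab$ in $\operatorname{End}(A)$. All tensor products of spaces of maps are regarded as subspaces of $\operatorname{End}_{\mathbb C}(\mathfrak{g}\otimes A)$ via $(T\otimes f)(x\otimes b) = T(x)\otimes f(b)$; in particular $(D\otimes a)(x\otimes b)=D(x)\otimes ab$. With these identifications (a known result of Zusmanovich), $\operatorname{Der}(\mathfrak{g}_A) = \operatorname{Der}(\mathfrak{g})\otimes A + \operatorname{Hom}_{\mathfrak{g}}(\mathfrak{g},\mathfrak{g})\otimes\operatorname{Der}(A)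 + \operatorname{Hom}(\mathfrak{g}/[\mathfrak{g},\mathfrak{g}],\mathfrak{z}(\mathfrak{g}))\otimes\operatorname{End}(A)$. The radical of a finite dimensional Lie algebra is its maximal solvable ideal. *)

theory Defs
  imports Complex_Main "HOL-Library.Poly_Mapping" "HOL-Library.Set_Algebras"
begin

class complex_vector = ab_group_add +
  fixes scaleC :: "complex \<Rightarrow> 'a \<Rightarrow> 'a"  (infixr "*\<^sub>C" 75)
  assumes scaleC_add_right: "c *\<^sub>C (x + y) = c *\<^sub>C x + c *\<^sub>C y"
    and scaleC_add_left: "(c + d) *\<^sub>C x = c *\<^sub>C x + d *\<^sub>C x"
    and scaleC_scaleC: "c *\<^sub>C (d *\<^sub>C x) = (c * d) *\<^sub>C x"
    and scaleC_one: "1 *\<^sub>C x = x"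

global_interpretation complex_vector: vector_space "scaleC :: complex \<Rightarrow> 'a \<Rightarrow> 'a::complex_vector"
  defines csubspace = complex_vector.subspace
    and cspan = complex_vector.span
  by unfold_locales (auto simp: scaleC_add_right scaleC_add_left scaleC_scaleC scaleC_one)

abbreviation clinear :: "('a::complex_vector \<Rightarrow> 'b::complex_vector) \<Rightarrow> bool"
  where "clinear \<equiv> Vector_Spaces.linear scaleC scaleC"

lemma clinearI:
  fixes f :: "'a::complex_vector \<Rightarrow> 'b::complex_vector"
  assumes "\<And>x y. f (x + y) = f x + f y" and "\<And>c x. f (c *\<^sub>C x) = c *\<^sub>C f x"
  shows "clinear f"
  using assms by unfold_locales auto

lemma clinear_add: "clinear f \<Longrightarrow> f (x + y) = f x + f y"
  by (simp add: Vector_Spaces.linear_def module_hom_iff)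

lemma clinear_scale: "clinear f \<Longrightarrow> f (c *\<^sub>C x) = c *\<^sub>C f x"
  by (simp add: Vector_Spaces.linear_def module_hom_iff)

lemma clinear_zero: "clinear f \<Longrightarrow> f 0 = 0"
  using clinear_scale[of f 0 0] by simp

lemma clinear_minus: "clinear f \<Longrightarrow> f (- x) = - f x"
  using clinear_scale[of f "-1" x] by simp

lemma clinear_diff: "clinear f \<Longrightarrow> f (x - y) = f x - f y"
  using clinear_add[of f x "- y"] by (simp add: clinear_minus)

lemma clinear_compose:
  assumes "clinear f" and "clinear g"
  shows "clinear (\<lambda>x. f (g x))"
  using assms by (auto intro!: clinearI simp: clinear_add[of f] clinear_add[of g]
      clinear_scale[of f] clinear_scale[of g])

lemma clinear_compose_add:
  assumes "clinear f" and "clinear g"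
  shows "clinear (\<lambda>x. f x + g x)"
  using assms by (auto intro!: clinearI simp: clinear_add[of f] clinear_add[of g]
      clinear_scale[of f] clinear_scale[of g] scaleC_add_right)

lemma clinear_compose_scale:
  assumes "clinear f"
  shows "clinear (\<lambda>x. c *\<^sub>C f x)"
  using assms by (auto intro!: clinearI simp: clinear_add[of f] clinear_scale[of f]
      scaleC_add_right scaleC_scaleC mult.commute)

lemma clinear_compose_minus:
  assumes "clinear f"
  shows "clinear (\<lambda>x. - f x)"
  using clinear_compose_scale[OF assms, of "-1"] by simp

lemma clinear_compose_diff:
  assumes "clinear f" and "clinear g"
  shows "clinear (\<lambda>x. f x - g x)"
  using clinear_compose_add[OF assms(1) clinear_compose_minus[OF assms(2)]] by simp

definition cbilinear :: "('a::complex_vector \<Rightarrow> 'b::complex_vector \<Rightarrow> 'c::complex_vector) \<Rightarrow> bool"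
  where "cbilinear h \<longleftrightarrow> (\<forall>x. clinear (h x)) \<and> (\<forall>y. clinear (\<lambda>x. h x y))"

definition finite_dim :: "'a::complex_vector itself \<Rightarrow> bool"
  where "finite_dim _ \<longleftrightarrow> (\<exists>B :: 'a set. finite B \<and> cspan B = UNIV)"

instantiation complex :: complex_vector
begin
definition scaleC_complex :: "complex \<Rightarrow> complex \<Rightarrow> complex"
  where "scaleC_complex = (*)"
instance
  by standard (auto simp: scaleC_complex_def algebra_simps)
end

text \<open>Associative, commutative and unital complex algebras.  The base class is not \<^class>\<open>comm_ring_1\<close> because
  that class excludes the zero algebra.\<close>

class complex_comm_algebra = complex_vector + comm_ring + comm_monoid_mult +
  assumes scaleC_mult_left: "(c *\<^sub>C a) * b = c *\<^sub>C (a * b)"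

lemma scaleC_mult_right: "a * (c *\<^sub>C b) = c *\<^sub>C (a * b :: 'a::complex_comm_algebra)"
  by (metis mult.commute scaleC_mult_left)

definition subalgebra :: "'a::complex_comm_algebra set \<Rightarrow> bool"
  where "subalgebra S \<longleftrightarrow> csubspace S \<and> 1 \<in> S \<and> (\<forall>a\<in>S. \<forall>b\<in>S. a * b \<in> S)"

definition ring_ideal_of :: "'a::complex_comm_algebra set \<Rightarrow> 'a set \<Rightarrow> bool"
  where "ring_ideal_of I S \<longleftrightarrow>
    I \<subseteq> S \<and> 0 \<in> I \<and> (\<forall>a\<in>I. \<forall>b\<in>I. a + b \<in> I) \<and> (\<forall>s\<in>S. \<forall>a\<in>I. s * a \<in> I)"

definition maximal_ideal_of :: "'a::complex_comm_algebra set \<Rightarrow> 'a set \<Rightarrow> bool"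
  where "maximal_ideal_of M S \<longleftrightarrow>
    ring_ideal_of M S \<and> M \<noteq> S \<and> (\<forall>I. ring_ideal_of I S \<longrightarrow> M \<subseteq> I \<longrightarrow> I = M \<or> I = S)"

text \<open>Jacobson radical of a subalgebra; the intersection with \<open>S\<close> only matters for \<open>S = 0\<close>, which
  has no maximal ideals.\<close>

definition jacobson_radical :: "'a::complex_comm_algebra set \<Rightarrow> 'a set"
  where "jacobson_radical S = S \<inter> \<Inter>{M. maximal_ideal_of M S}"

text \<open>To be used for finite dimensional \<open>S\<close> only, where vanishing of the Jacobson radical is the
  usual definition of semisimplicity.\<close>

definition semisimple_subalgebra :: "'a::complex_comm_algebra set \<Rightarrow> bool"
  where "semisimple_subalgebra S \<longleftrightarrow> subalgebra S \<and> jacobson_radical S = {0}"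

class lie_algebra = complex_vector +
  fixes lie :: "'a \<Rightarrow> 'a \<Rightarrow> 'a"
  assumes lie_add_left: "lie (x + y) z = lie x z + lie y z"
    and lie_add_right: "lie x (y + z) = lie x y + lie x z"
    and lie_scale_left: "lie (c *\<^sub>C x) y = c *\<^sub>C lie x y"
    and lie_scale_right: "lie x (c *\<^sub>C y) = c *\<^sub>C lie x y"
    and lie_self: "lie x x = 0"
    and lie_jacobi: "lie x (lie y z) + lie y (lie z x) + lie z (lie x y) = 0"

lemma cbilinear_lie: "cbilinear (lie :: 'a::lie_algebra \<Rightarrow> 'a \<Rightarrow> 'a)"
  unfolding cbilinear_def
  by (intro conjI allI clinearI)
    (auto simp: lie_add_left lie_add_right lie_scale_left lie_scale_right)

lemma lie_anticomm: "lie y x = - lie x (y :: 'a::lie_algebra)"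
proof -
  have "lie (x + y) (x + y) = lie x y + lie y x"
    by (simp only: lie_add_left lie_add_right) (simp add: lie_self)
  then have "lie x y + lie y x = 0"
    using lie_self[of "x + y"] by simp
  then show ?thesis
    by (simp add: eq_neg_iff_add_eq_0 add.commute)
qed

definition lie_subalgebra :: "'a::lie_algebra set \<Rightarrow> bool"
  where "lie_subalgebra L \<longleftrightarrow> csubspace L \<and> (\<forall>x\<in>L. \<forall>y\<in>L. lie x y \<in> L)"

definition lie_ideal :: "'a::lie_algebra set \<Rightarrow> 'a set \<Rightarrow> bool"
  where "lie_ideal I L \<longleftrightarrow> csubspace I \<and> I \<subseteq> L \<and> (\<forall>x\<in>L. \<forall>y\<in>I. lie x y \<in> I)"

definition lie_product :: "'a::lie_algebra set \<Rightarrow> 'a set \<Rightarrow> 'a set"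
  where "lie_product U V = cspan {lie x y | x y. x \<in> U \<and> y \<in> V}"

primrec derived_series :: "nat \<Rightarrow> 'a::lie_algebra set \<Rightarrow> 'a set"
  where "derived_series 0 L = L"
  | "derived_series (Suc n) L = lie_product (derived_series n L) (derived_series n L)"

definition lie_solvable :: "'a::lie_algebra set \<Rightarrow> bool"
  where "lie_solvable L \<longleftrightarrow> lie_subalgebra L \<and> (\<exists>n. derived_series n L = {0})"

text \<open>Maximality among solvable ideals is taken as being the largest one; in finite dimension the two
  readings agree.\<close>

definition is_lie_radical :: "'a::lie_algebra set \<Rightarrow> 'a set \<Rightarrow> bool"
  where "is_lie_radical R L \<longleftrightarrow> lie_ideal R L \<and> lie_solvable R \<and>
    (\<forall>I. lie_ideal I L \<longrightarrow> lie_solvable I \<longrightarrow> I \<subseteq> R)"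

text \<open>Following the usual convention, the zero Lie algebra is semisimple.\<close>

definition lie_semisimple :: "'a::lie_algebra set \<Rightarrow> bool"
  where "lie_semisimple L \<longleftrightarrow> lie_subalgebra L \<and> is_lie_radical {0} L"

text \<open>In \<open>\<ss> + \<rr>\<close>, as for all sums of subspaces below, \<open>+\<close> is the elementwise sum of sets.\<close>

definition levi_decomposition :: "'a::lie_algebra set \<Rightarrow> 'a set \<Rightarrow> 'a set \<Rightarrow> bool"
  where "levi_decomposition L \<ss> \<rr> \<longleftrightarrow> is_lie_radical \<rr> L \<and>
    lie_semisimple \<ss> \<and> \<ss> \<subseteq> L \<and> \<ss> \<inter> \<rr> = {0} \<and> \<ss> + \<rr> = L"

definition lie_center :: "'a::lie_algebra set"
  where "lie_center = {z. \<forall>x. lie x z = 0}"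

typedef (overloaded) 'v endo = "{f :: 'v::complex_vector \<Rightarrow> 'v. clinear f}"
  morphisms app Endo
  by (rule exI[of _ "\<lambda>_. 0"]) (simp add: clinearI)

setup_lifting type_definition_endo

lemma clinear_app [simp]: "clinear (app T)"
  using app[of T] by simp

lemma endo_eqI: "(\<And>x. app S x = app T x) \<Longrightarrow> S = T"
  by (metis app_inject ext)

instantiation endo :: (complex_vector) complex_vector
begin

lift_definition zero_endo :: "'a endo" is "\<lambda>_. 0"
  by (simp add: clinearI)
lift_definition plus_endo :: "'a endo \<Rightarrow> 'a endo \<Rightarrow> 'a endo" is "\<lambda>S T x. S x + T x"
  by (rule clinear_compose_add)
lift_definition minus_endo :: "'a endo \<Rightarrow> 'a endo \<Rightarrow> 'a endo" is "\<lambda>S T x. S x - T x"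
  by (rule clinear_compose_diff)
lift_definition uminus_endo :: "'a endo \<Rightarrow> 'a endo" is "\<lambda>S x. - S x"
  by (rule clinear_compose_minus)
lift_definition scaleC_endo :: "complex \<Rightarrow> 'a endo \<Rightarrow> 'a endo" is "\<lambda>c S x. c *\<^sub>C S x"
  by (rule clinear_compose_scale)

instance
proof
  fix a b c :: "'a endo" and u v :: complex
  show "a + b + c = a + (b + c)" by transfer (simp add: add.assoc)
  show "a + b = b + a" by transfer (simp add: add.commute)
  show "0 + a = a" by transfer simp
  show "- a + a = 0" by transfer simp
  show "a - b = a + - b" by transfer simp
  show "u *\<^sub>C (a + b) = u *\<^sub>C a + u *\<^sub>C b" by transfer (simp add: scaleC_add_right)
  show "(u + v) *\<^sub>C a = u *\<^sub>C a + v *\<^sub>C a" by transfer (simp add: scaleC_add_left)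
  show "u *\<^sub>C v *\<^sub>C a = (u * v) *\<^sub>C a" by transfer (simp add: scaleC_scaleC)
  show "1 *\<^sub>C a = a" by transfer (simp add: scaleC_one)
qed

end

lemma app_add [simp]: "app T (x + y) = app T x + app T y"
  and app_diff [simp]: "app T (x - y) = app T x - app T y"
  and app_scale [simp]: "app T (c *\<^sub>C x) = c *\<^sub>C app T x"
  and app_zero [simp]: "app T 0 = 0"
  and app_minus [simp]: "app T (- x) = - app T x"
  by (simp_all only: clinear_add[OF clinear_app] clinear_diff[OF clinear_app]
      clinear_scale[OF clinear_app] clinear_zero[OF clinear_app] clinear_minus[OF clinear_app])

text \<open>The full endomorphism type is the ambient Lie algebra for all Lie algebras of derivations;
  its bracket is the commutator.\<close>

instantiation endo :: (complex_vector) lie_algebra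
begin

lift_definition lie_endo :: "'a endo \<Rightarrow> 'a endo \<Rightarrow> 'a endo" is "\<lambda>S T x. S (T x) - T (S x)"
  by (rule clinear_compose_diff) (rule clinear_compose; assumption)+

instance
proof
  fix x y z :: "'a endo" and c :: complex
  note rep = lie_endo.rep_eq plus_endo.rep_eq scaleC_endo.rep_eq zero_endo.rep_eq
    complex_vector.scale_right_diff_distrib
  show "lie (x + y) z = lie x z + lie y z" by (rule endo_eqI) (simp add: rep)
  show "lie x (y + z) = lie x y + lie x z" by (rule endo_eqI) (simp add: rep)
  show "lie (c *\<^sub>C x) y = c *\<^sub>C lie x y" by (rule endo_eqI) (simp add: rep)
  show "lie x (c *\<^sub>C y) = c *\<^sub>C lie x y" by (rule endo_eqI) (simp add: rep)
  show "lie x x = 0" by (rule endo_eqI) (simp add: rep)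
  show "lie x (lie y z) + lie y (lie z x) + lie z (lie x y) = 0"
    by (rule endo_eqI) (simp add: rep)
qed

end

definition lie_derivations :: "'g::lie_algebra endo set"
  where "lie_derivations = {D. \<forall>x y. app D (lie x y) = lie (app D x) y + lie x (app D y)}"

definition algebra_derivations :: "'a::complex_comm_algebra endo set"
  where "algebra_derivations = {d. \<forall>a b. app d (a * b) = app d a * b + a * app d b}"

definition centroid :: "'g::lie_algebra endo set"
  where "centroid = {T. \<forall>x. lie x \<circ> app T = app T \<circ> lie x}"

text \<open>Linear maps from \<open>\<gg>/[\<gg>,\<gg>]\<close> to the center, regarded as maps \<open>\<gg> \<rightarrow> \<gg>\<close> vanishing on
  \<open>[\<gg>,\<gg>]\<close>.\<close>

definition central_homs :: "'g::lie_algebra endo set"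
  where "central_homs =
    {T. (\<forall>x \<in> lie_product UNIV UNIV. app T x = 0) \<and> range (app T) \<subseteq> lie_center}"

text \<open>The identification of an algebra element with the multiplication by it.\<close>

lift_definition mult_endo :: "'a::complex_comm_algebra \<Rightarrow> 'a endo" is "\<lambda>a b. a * b"
  by (rule clinearI) (simp_all add: distrib_left scaleC_mult_right)

text \<open>Finitely supported functions \<open>'k \<Rightarrow>\<^sub>0 complex\<close> are the free vector space on \<open>'k\<close>.\<close>

instantiation poly_mapping :: (type, complex_vector) complex_vector
begin

lift_definition scaleC_poly_mapping :: "complex \<Rightarrow> ('a \<Rightarrow>\<^sub>0 'b) \<Rightarrow> ('a \<Rightarrow>\<^sub>0 'b)"
  is "\<lambda>c p k. c *\<^sub>C p k"
  by (erule rev_finite_subset) auto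

instance
  by standard (transfer; auto simp: scaleC_add_right scaleC_add_left scaleC_scaleC scaleC_one)+

end

definition tensor_relations :: "('v::complex_vector \<times> 'w::complex_vector \<Rightarrow>\<^sub>0 complex) set"
  where "tensor_relations =
    {Poly_Mapping.single (x + y, b) 1 - Poly_Mapping.single (x, b) 1 - Poly_Mapping.single (y, b) 1
      | x y b. True} \<union>
    {Poly_Mapping.single (x, a + b) 1 - Poly_Mapping.single (x, a) 1 - Poly_Mapping.single (x, b) 1
      | x a b. True} \<union>
    {Poly_Mapping.single (c *\<^sub>C x, b) 1 - c *\<^sub>C Poly_Mapping.single (x, b) 1 | c x b. True} \<union>
    {Poly_Mapping.single (x, c *\<^sub>C b) 1 - c *\<^sub>C Poly_Mapping.single (x, b) 1 | c x b. True}"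

definition tensor_rel ::
    "('v::complex_vector \<times> 'w::complex_vector \<Rightarrow>\<^sub>0 complex) \<Rightarrow> ('v \<times> 'w \<Rightarrow>\<^sub>0 complex) \<Rightarrow> bool"
  where "tensor_rel p q \<longleftrightarrow> p - q \<in> cspan tensor_relations"

quotient_type (overloaded) ('v, 'w) tensor =
  "('v::complex_vector \<times> 'w::complex_vector) \<Rightarrow>\<^sub>0 complex" / tensor_rel
proof (rule equivpI)
  show "reflp (tensor_rel :: ('v \<times> 'w \<Rightarrow>\<^sub>0 complex) \<Rightarrow> _)"
    by (simp add: reflp_def tensor_rel_def complex_vector.span_zero)
  show "symp (tensor_rel :: ('v \<times> 'w \<Rightarrow>\<^sub>0 complex) \<Rightarrow> _)"
    unfolding symp_def tensor_rel_def
    by (intro allI impI) (drule complex_vector.span_neg, simp)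
  show "transp (tensor_rel :: ('v \<times> 'w \<Rightarrow>\<^sub>0 complex) \<Rightarrow> _)"
    unfolding transp_def tensor_rel_def
    by (intro allI impI) (drule (1) complex_vector.span_add, simp)
qed

instantiation tensor :: (complex_vector, complex_vector) complex_vector
begin

lift_definition zero_tensor :: "('a, 'b) tensor" is 0 .
lift_definition plus_tensor :: "('a, 'b) tensor \<Rightarrow> ('a, 'b) tensor \<Rightarrow> ('a, 'b) tensor" is "(+)"
  unfolding tensor_rel_def add_diff_add by (rule complex_vector.span_add)
lift_definition minus_tensor :: "('a, 'b) tensor \<Rightarrow> ('a, 'b) tensor \<Rightarrow> ('a, 'b) tensor" is "(-)"
proof -
  fix p p' q q' :: "'a \<times> 'b \<Rightarrow>\<^sub>0 complex"
  assume "tensor_rel p p'" "tensor_rel q q'"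
  moreover have "(p - q) - (p' - q') = (p - p') - (q - q')" by (simp add: algebra_simps)
  ultimately show "tensor_rel (p - q) (p' - q')"
    unfolding tensor_rel_def by (simp only: complex_vector.span_diff)
qed
lift_definition uminus_tensor :: "('a, 'b) tensor \<Rightarrow> ('a, 'b) tensor" is uminus
  unfolding tensor_rel_def minus_diff_minus by (rule complex_vector.span_neg)
lift_definition scaleC_tensor :: "complex \<Rightarrow> ('a, 'b) tensor \<Rightarrow> ('a, 'b) tensor" is scaleC
  unfolding tensor_rel_def complex_vector.scale_right_diff_distrib[symmetric]
  by (rule complex_vector.span_scale)

instance
proof
  fix a b c :: "('a, 'b) tensor" and u v :: complex
  show "a + b + c = a + (b + c)" by transfer (simp add: tensor_rel_def add.assoc complex_vector.span_zero)
  show "a + b = b + a" by transfer (simp add: tensor_rel_def add.commute complex_vector.span_zero)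
  show "0 + a = a" by transfer (simp add: tensor_rel_def complex_vector.span_zero)
  show "- a + a = 0" by transfer (simp add: tensor_rel_def complex_vector.span_zero)
  show "a - b = a + - b" by transfer (simp add: tensor_rel_def complex_vector.span_zero)
  show "u *\<^sub>C (a + b) = u *\<^sub>C a + u *\<^sub>C b"
    by transfer (simp add: tensor_rel_def complex_vector.span_zero scaleC_add_right)
  show "(u + v) *\<^sub>C a = u *\<^sub>C a + v *\<^sub>C a"
    by transfer (simp add: tensor_rel_def complex_vector.span_zero scaleC_add_left)
  show "u *\<^sub>C v *\<^sub>C a = (u * v) *\<^sub>C a"
    by transfer (simp add: tensor_rel_def complex_vector.span_zero scaleC_scaleC)
  show "1 *\<^sub>C a = a"
    by transfer (simp add: tensor_rel_def complex_vector.span_zero scaleC_one)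
qed

end

lift_definition tens :: "'v::complex_vector \<Rightarrow> 'w::complex_vector \<Rightarrow> ('v, 'w) tensor"
  is "\<lambda>x b. Poly_Mapping.single (x, b) 1" .

lemma cbilinear_tens: "cbilinear (tens :: 'v::complex_vector \<Rightarrow> 'w::complex_vector \<Rightarrow> _)"
  unfolding cbilinear_def
proof (intro conjI allI clinearI)
  fix x y :: 'v and a b :: 'w and c :: complex
  note rel = tensor_rel_def diff_diff_eq[symmetric]
  show "tens x (a + b) = tens x a + tens x b"
    by transfer (unfold rel tensor_relations_def, rule complex_vector.span_base, blast)
  show "tens (x + y) b = tens x b + tens y b"
    by transfer (unfold rel tensor_relations_def, rule complex_vector.span_base, blast)
  show "tens x (c *\<^sub>C b) = c *\<^sub>C tens x b"
    by transfer (unfold rel tensor_relations_def, rule complex_vector.span_base, blast)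
  show "tens (c *\<^sub>C x) b = c *\<^sub>C tens x b"
    by transfer (unfold rel tensor_relations_def, rule complex_vector.span_base, blast)
qed

lemma tensor_induct [case_names zero add tens]:
  fixes t :: "('v::complex_vector, 'w::complex_vector) tensor"
  assumes "P 0" and "\<And>s t. P s \<Longrightarrow> P t \<Longrightarrow> P (s + t)" and "\<And>x b. P (tens x b)"
  shows "P t"
proof -
  have "P (abs_tensor p)" for p :: "'v \<times> 'w \<Rightarrow>\<^sub>0 complex"
  proof (induction p rule: update_induct)
    case const
    then show ?case using assms(1) by (simp add: zero_tensor.abs_eq)
  next
    case (update p k c)
    obtain x b where k: "k = (x, b)" by (cases k)
    have "Poly_Mapping.update k c p = p + c *\<^sub>C Poly_Mapping.single (x, b) 1"
      using update(1) by (intro poly_mapping_eqI)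
        (auto simp: k scaleC_poly_mapping.rep_eq lookup_update lookup_add lookup_single when_def
          scaleC_complex_def in_keys_iff)
    then have "abs_tensor (Poly_Mapping.update k c p) = abs_tensor p + c *\<^sub>C tens x b"
      by (simp add: tens.abs_eq scaleC_tensor.abs_eq plus_tensor.abs_eq)
    also have "c *\<^sub>C tens x b = tens (c *\<^sub>C x) b"
      using clinear_scale[of "\<lambda>x. tens x b"] cbilinear_tens unfolding cbilinear_def by metis
    finally show ?case using assms(2,3) update(3) by simp
  qed
  then show ?thesis by (induction t rule: tensor.abs_induct) auto
qed

text \<open>The linear map on the free space induced by \<open>h\<close>; for bilinear \<open>h\<close> it descends to the tensor
  product.\<close>

definition free_lift ::
    "('v \<Rightarrow> 'w \<Rightarrow> 'u::complex_vector) \<Rightarrow> ('v \<times> 'w \<Rightarrow>\<^sub>0 complex) \<Rightarrow> 'u"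
  where "free_lift h p =
    (\<Sum>k \<in> Poly_Mapping.keys p. Poly_Mapping.lookup p k *\<^sub>C h (fst k) (snd k))"

definition tensor_lift ::
    "('v::complex_vector \<Rightarrow> 'w::complex_vector \<Rightarrow> 'u::complex_vector) \<Rightarrow> ('v, 'w) tensor \<Rightarrow> 'u"
  where "tensor_lift h t = free_lift h (rep_tensor t)"

lemma clinear_free_lift: "clinear (free_lift h)"
proof (rule clinearI)
  show "free_lift h (p + q) = free_lift h p + free_lift h q" for p q
    unfolding free_lift_def by (rule setsum_keys_plus_distrib) (simp_all add: scaleC_add_left)
  show "free_lift h (c *\<^sub>C p) = c *\<^sub>C free_lift h p" for c p
  proof (cases "c = 0")
    case False
    then have "Poly_Mapping.keys (c *\<^sub>C p) = Poly_Mapping.keys p"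
      by (auto simp: in_keys_iff scaleC_poly_mapping.rep_eq scaleC_complex_def)
    then show ?thesis
      by (simp add: free_lift_def complex_vector.scale_sum_right scaleC_poly_mapping.rep_eq
          scaleC_complex_def scaleC_scaleC)
  qed (simp add: free_lift_def)
qed

lemma free_lift_single: "free_lift h (Poly_Mapping.single (x, b) 1) = h x b"
  by (simp add: free_lift_def scaleC_one)

lemma free_lift_relations:
  assumes h: "cbilinear h" and p: "p \<in> cspan tensor_relations"
  shows "free_lift h p = 0"
proof -
  note [simp] = clinear_diff[OF clinear_free_lift] clinear_scale[OF clinear_free_lift]
    free_lift_single
  have l: "clinear (h x)" and r: "clinear (\<lambda>x. h x y)" for x y
    using h by (auto simp: cbilinear_def)
  note [simp] = clinear_add[OF l] clinear_add[OF r] clinear_scale[OF l] clinear_scale[OF r]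
  have "csubspace {p. free_lift h p = 0}"
    unfolding complex_vector.subspace_def
    using clinear_add[OF clinear_free_lift[of h]] clinear_zero[OF clinear_free_lift[of h]] by simp
  moreover have "tensor_relations \<subseteq> {p. free_lift h p = 0}"
    unfolding tensor_relations_def by auto
  ultimately show ?thesis
    using p complex_vector.span_minimal by blast
qed

lemma tensor_lift_abs:
  assumes h: "cbilinear h"
  shows "tensor_lift h (abs_tensor p) = free_lift h p"
proof -
  have "tensor_rel (rep_tensor (abs_tensor p)) p"
    by (rule Quotient3_rep_abs[OF Quotient3_tensor])
       (simp add: tensor_rel_def complex_vector.span_zero)
  then have "free_lift h (rep_tensor (abs_tensor p) - p) = 0"
    unfolding tensor_rel_def by (rule free_lift_relations[OF h])
  then show ?thesis
    by (simp add: tensor_lift_def clinear_diff[OF clinear_free_lift])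
qed

lemma clinear_tensor_lift:
  fixes h :: "'v::complex_vector \<Rightarrow> 'w::complex_vector \<Rightarrow> 'u::complex_vector"
  assumes h: "cbilinear h"
  shows "clinear (tensor_lift h)"
proof (rule clinearI)
  fix s t :: "('v, 'w) tensor" and c
  obtain p q where "s = abs_tensor p" "t = abs_tensor q"
    using tensor.abs_induct[of "\<lambda>t. \<exists>p. t = abs_tensor p"] by metis
  then show "tensor_lift h (s + t) = tensor_lift h s + tensor_lift h t"
    "tensor_lift h (c *\<^sub>C s) = c *\<^sub>C tensor_lift h s"
    by (simp_all add: plus_tensor.abs_eq scaleC_tensor.abs_eq tensor_lift_abs[OF h]
        clinear_add[OF clinear_free_lift] clinear_scale[OF clinear_free_lift])
qed

lemma tensor_lift_tens [simp]: "cbilinear h \<Longrightarrow> tensor_lift h (tens x b) = h x b"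
  by (simp add: tens.abs_eq tensor_lift_abs free_lift_single)

lemma tensor_lift_unique:
  assumes f: "clinear f" and g: "clinear g" and eq: "\<And>x b. f (tens x b) = g (tens x b)"
  shows "f t = g t"
  by (induction t rule: tensor_induct)
    (simp_all add: eq clinear_zero[OF f] clinear_zero[OF g] clinear_add[OF f] clinear_add[OF g])

text \<open>\<open>tensor_endo T f\<close> is \<open>T \<otimes> f\<close>; its characterization is \<open>app_tensor_endo\<close> below.\<close>

definition tensor_endo ::
    "'v::complex_vector endo \<Rightarrow> 'w::complex_vector endo \<Rightarrow> ('v, 'w) tensor endo"
  where "tensor_endo T f = Endo (tensor_lift (\<lambda>x b. tens (app T x) (app f b)))"

lemma app_tensor_endo [simp]: "app (tensor_endo T f) (tens x b) = tens (app T x) (app f b)"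
proof -
  have "cbilinear (\<lambda>x b. tens (app T x) (app f b))"
    using cbilinear_tens unfolding cbilinear_def
    by (auto intro!: clinear_compose[OF _ clinear_app, of "tens _"]
        clinear_compose[OF _ clinear_app, of "\<lambda>x. tens x _"])
  then show ?thesis
    by (simp add: tensor_endo_def Endo_inverse clinear_tensor_lift)
qed

text \<open>\<open>U \<otimes> W\<close> for spaces of maps, realized inside \<open>End(V \<otimes> W)\<close>.\<close>

definition tensor_maps ::
    "'v::complex_vector endo set \<Rightarrow> 'w::complex_vector endo set \<Rightarrow> ('v, 'w) tensor endo set"
  where "tensor_maps U W = cspan {tensor_endo T f | T f. T \<in> U \<and> f \<in> W}"

text \<open>The current Lie algebra \<open>\<gg> \<otimes> A\<close>; see \<open>lie_tens\<close> below.\<close>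

definition current_right ::
    "'g::lie_algebra \<Rightarrow> 'a::complex_comm_algebra \<Rightarrow> ('g, 'a) tensor \<Rightarrow> ('g, 'a) tensor"
  where "current_right x a = tensor_lift (\<lambda>y b. tens (lie x y) (a * b))"

definition current_bracket ::
    "('g::lie_algebra, 'a::complex_comm_algebra) tensor \<Rightarrow> ('g, 'a) tensor \<Rightarrow> ('g, 'a) tensor"
  where "current_bracket s t = tensor_lift (\<lambda>x a. current_right x a t) s"

lemma tens_simps:
  "tens (x + y) b = tens x b + tens y b" "tens x (a + b) = tens x a + tens x b"
  "tens (c *\<^sub>C x) b = c *\<^sub>C tens x b" "tens x (c *\<^sub>C b) = c *\<^sub>C tens x b"
  "tens 0 b = 0" "tens x 0 = 0" "tens (- x) b = - tens x b" "tens x (- b) = - tens x b"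
proof -
  have l: "clinear (tens x)" and r: "clinear (\<lambda>x. tens x b)" for x b
    using cbilinear_tens unfolding cbilinear_def by auto
  show "tens (x + y) b = tens x b + tens y b" "tens x (a + b) = tens x a + tens x b"
    "tens (c *\<^sub>C x) b = c *\<^sub>C tens x b" "tens x (c *\<^sub>C b) = c *\<^sub>C tens x b"
    "tens 0 b = 0" "tens x 0 = 0" "tens (- x) b = - tens x b" "tens x (- b) = - tens x b"
    by (simp_all only: clinear_add[OF l] clinear_add[OF r] clinear_scale[OF l] clinear_scale[OF r]
        clinear_zero[OF l] clinear_zero[OF r] clinear_minus[OF l] clinear_minus[OF r])
qed

lemma cbilinear_current_aux:
  "cbilinear (\<lambda>y b. tens (lie x y) (a * b :: 'a::complex_comm_algebra))"
  unfolding cbilinear_def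
  by (intro conjI allI clinearI)
    (simp_all add: tens_simps lie_add_right lie_scale_right distrib_left scaleC_mult_right)

lemma clinear_current_right: "clinear (current_right x a)"
  unfolding current_right_def by (rule clinear_tensor_lift[OF cbilinear_current_aux])

lemma current_right_tens: "current_right x a (tens y b) = tens (lie x y) (a * b)"
  by (simp add: current_right_def cbilinear_current_aux)

lemma cbilinear_current_right: "cbilinear (\<lambda>x a. current_right x a t)"
proof -
  note lin = clinear_current_right clinear_compose_add clinear_compose_scale
  have "current_right (x + y) a t = current_right x a t + current_right y a t"
    "current_right (c *\<^sub>C x) a t = c *\<^sub>C current_right x a t"
    "current_right x (a + b) t = current_right x a t + current_right x b t"
    "current_right x (c *\<^sub>C a) t = c *\<^sub>C current_right x a t" for x y a b c
    by (rule tensor_lift_unique; (intro lin)?;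
        simp add: current_right_tens tens_simps lie_add_left lie_scale_left distrib_right
          scaleC_mult_left)+
  then show ?thesis
    unfolding cbilinear_def by (intro conjI allI clinearI)
qed

lemma clinear_current_left: "clinear (\<lambda>s. current_bracket s t)"
  unfolding current_bracket_def by (rule clinear_tensor_lift[OF cbilinear_current_right])

lemma current_bracket_tens_left: "current_bracket (tens x a) t = current_right x a t"
  by (simp add: current_bracket_def cbilinear_current_right)

lemma current_bracket_tens:
  "current_bracket (tens x a) (tens y b) = tens (lie x y) (a * b)"
  by (simp add: current_bracket_tens_left current_right_tens)

lemma current_bracket_add_left:
  "current_bracket (r + s) t = current_bracket r t + current_bracket s t"
  by (rule clinear_add[OF clinear_current_left])

lemma current_bracket_scale_left: "current_bracket (c *\<^sub>C s) t = c *\<^sub>C current_bracket s t"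
  by (rule clinear_scale[OF clinear_current_left])

lemma current_bracket_zero_left: "current_bracket 0 t = 0"
  by (rule clinear_zero[OF clinear_current_left])

lemma current_bracket_add_right:
  "current_bracket s (t + r) = current_bracket s t + current_bracket s r"
  by (induction s rule: tensor_induct)
    (simp_all add: current_bracket_zero_left current_bracket_add_left current_bracket_tens_left
      clinear_add[OF clinear_current_right] algebra_simps)

lemma current_bracket_scale_right: "current_bracket s (c *\<^sub>C t) = c *\<^sub>C current_bracket s t"
  by (induction s rule: tensor_induct)
    (simp_all add: current_bracket_zero_left current_bracket_add_left current_bracket_tens_left
      clinear_scale[OF clinear_current_right] scaleC_add_right)

lemma current_bracket_zero_right: "current_bracket s 0 = 0"
  using current_bracket_scale_right[of s 0 0] by simp

lemma current_bracket_anticomm: "current_bracket s t = - current_bracket t s"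
proof (induction s rule: tensor_induct)
  case (tens x a)
  show ?case
  proof (induction t rule: tensor_induct)
    case (tens y b)
    show ?case
      by (simp add: current_bracket_tens lie_anticomm[of y x] tens_simps mult.commute)
  qed (simp_all add: current_bracket_zero_left current_bracket_zero_right
      current_bracket_add_left current_bracket_add_right)
qed (simp_all add: current_bracket_zero_left current_bracket_zero_right
      current_bracket_add_left current_bracket_add_right)

lemma current_bracket_self: "current_bracket s s = 0"
proof -
  have "2 *\<^sub>C current_bracket s s = (1 + 1) *\<^sub>C current_bracket s s"
    by simp
  also have "\<dots> = current_bracket s s + current_bracket s s"
    by (simp only: scaleC_add_left scaleC_one)
  also have "\<dots> = 0"
    using current_bracket_anticomm[of s s] by (simp add: eq_neg_iff_add_eq_0)
  finally show ?thesis
    by simp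
qed

lemma current_bracket_jacobi:
  "current_bracket r (current_bracket s t) + current_bracket s (current_bracket t r)
    + current_bracket t (current_bracket r s) = 0"
proof -
  note [simp] = current_bracket_zero_left current_bracket_zero_right
    current_bracket_add_left current_bracket_add_right
  define J where "J r s t = current_bracket r (current_bracket s t)
    + current_bracket s (current_bracket t r) + current_bracket t (current_bracket r s)"
    for r s t :: "('a, 'b) tensor"
  have add: "J (r + r') s t = J r s t + J r' s t" "J r (s + s') t = J r s t + J r s' t"
      "J r s (t + t') = J r s t + J r s t'"
    and zero: "J 0 s t = 0" "J r 0 t = 0" "J r s 0 = 0" for r r' s s' t t'
    by (simp_all add: J_def algebra_simps)
  have tens: "J (tens x a) (tens y b) (tens z c) = 0" for x y z a b c
  proof -
    have "b * (c * a) = a * (b * c)" "c * (a * b) = a * (b * c)"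
      by (simp_all add: ac_simps)
    then show ?thesis
      by (simp add: J_def current_bracket_tens lie_jacobi tens_simps(5) flip: tens_simps(1))
  qed
  have "J (tens x a) (tens y b) t = 0" for x a y b
    by (induction t rule: tensor_induct) (simp_all add: add zero tens)
  then have "J (tens x a) s t = 0" for x a
    by (induction s rule: tensor_induct) (simp_all add: add zero)
  then have "J r s t = 0"
    by (induction r rule: tensor_induct) (simp_all add: add zero)
  then show ?thesis
    by (simp only: J_def)
qed

instantiation tensor :: (lie_algebra, complex_comm_algebra) lie_algebra
begin

definition lie_tensor :: "('a, 'b) tensor \<Rightarrow> ('a, 'b) tensor \<Rightarrow> ('a, 'b) tensor"
  where "lie_tensor = current_bracket"

instance
  by standard (simp_all only: lie_tensor_def current_bracket_add_left current_bracket_add_right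
      current_bracket_scale_left current_bracket_scale_right current_bracket_self
      current_bracket_jacobi)

end

lemma lie_tens: "lie (tens x a) (tens y b) = tens (lie x y) (a * b)"
  by (simp add: lie_tensor_def current_bracket_tens)

end

theory Submission
  imports Defs "HOL-Computational_Algebra.Fundamental_Theorem_Algebra"
begin

text \<open>Write \<open>h = g \<otimes> A\<close>.  By a lemma of Jacobson, derivations of \<open>A\<close> map into \<open>\<JJ>\<close>, and the commutator
  of a derivation of a Lie algebra with an element of its centroid is nilpotent.  Iterated joint
  kernels of the nilpotent elements of the centroid of \<open>h\<close>, starting from the center, therefore
  filter \<open>h\<close> by subspaces invariant under all derivations.  The derivations lowering this filtration
  form a solvable ideal (this is where the center has to lie in the derived algebra), and the ideal
  claimed to be the radical is, modulo the lowering derivations, built from \<open>\<rr> \<otimes> A\<close> and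
  \<open>centroid \<otimes> Der(A)\<close>, whose mixed brackets are lowering; hence it is solvable.  By
  Zusmanovich's description of \<open>Der(h)\<close> it is complemented by \<open>\<ss> \<otimes> S\<close>, which is semisimple because
  the characters of \<open>A\<close> separate the points of \<open>S\<close>.\<close>

section \<open>Linear algebra and the nilpotency of commutators\<close>

text \<open>The obstacle is that the centroid of \<open>h\<close> need not be commutative. It is
  commutative on [h,h], since T T' [x,y] = [T x, T' y] = T' T [x,y]; Jacobson's argument is
  therefore run on [h,h], and the inclusion of the center in [h,h] extends nilpotency to all of
  \<open>h\<close>. In general the commutator of two centroid elements maps into the center, which
  is why the filtration starts at the center and not at 0. The mixed brackets are lowering because
  [D \<otimes> a, T \<otimes> d] = [D,T] \<otimes> a d - T D \<otimes> d(a). Here [D,T] is nilpotent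
  in the centroid of \<open>g\<close> and d(a) lies in \<JJ>, so each summand is a derivation of
  \<open>h\<close> followed by a nilpotent element of the centroid of \<open>h\<close>: the first
  preserves the filtration and the second lowers it.\<close>

lemma csubspaceI:
  assumes "0 \<in> U" "\<And>x y. x \<in> U \<Longrightarrow> y \<in> U \<Longrightarrow> x + y \<in> U" "\<And>c x. x \<in> U \<Longrightarrow> c *\<^sub>C x \<in> U"
  shows "csubspace U"
  using assms unfolding complex_vector.subspace_def by blast

lemma csubspace_vimage:
  assumes "clinear f" "csubspace U"
  shows "csubspace {x. f x \<in> U}"
  using assms(2) unfolding complex_vector.subspace_def
  by (simp add: clinear_zero[OF assms(1)] clinear_add[OF assms(1)] clinear_scale[OF assms(1)])

lemma cspan_linear_mem:
  assumes "clinear f" "csubspace U" "x \<in> cspan X" "\<And>x. x \<in> X \<Longrightarrow> f x \<in> U"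
  shows "f x \<in> U"
  using complex_vector.span_minimal[OF _ csubspace_vimage[OF assms(1,2)], of X] assms(3,4) by blast

lemma cspan_bilinear_mem:
  assumes h: "cbilinear h" and U: "csubspace U" and x: "x \<in> cspan X" and y: "y \<in> cspan Y"
    and mem: "\<And>x y. x \<in> X \<Longrightarrow> y \<in> Y \<Longrightarrow> h x y \<in> U"
  shows "h x y \<in> U"
proof -
  have l: "clinear (h x)" and r: "clinear (\<lambda>x. h x y)" for x y
    using h by (auto simp: cbilinear_def)
  show ?thesis
    by (rule cspan_linear_mem[OF r U x]) (rule cspan_linear_mem[OF l U y], rule mem)
qed

lemma csubspace_image:
  assumes f: "clinear f" and U: "csubspace U"
  shows "csubspace (f ` U)"
proof (rule csubspaceI)
  show "0 \<in> f ` U"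
    using complex_vector.subspace_0[OF U] clinear_zero[OF f] by (metis image_eqI)
  show "x + y \<in> f ` U" if "x \<in> f ` U" "y \<in> f ` U" for x y
    using that complex_vector.subspace_add[OF U] by (auto simp flip: clinear_add[OF f])
  show "c *\<^sub>C x \<in> f ` U" if "x \<in> f ` U" for c x
    using that complex_vector.subspace_scale[OF U] by (auto simp flip: clinear_scale[OF f])
qed

lemma csubspace_plus:
  assumes U: "csubspace U" and W: "csubspace W"
  shows "csubspace (U + W)"
proof (rule csubspaceI)
  show "0 \<in> U + W"
    using set_plus_intro[OF complex_vector.subspace_0[OF U] complex_vector.subspace_0[OF W]] by simp
  show "x + y \<in> U + W" if x: "x \<in> U + W" and y: "y \<in> U + W" for x y
  proof -
    obtain u w u' w' where "x = u + w" "u \<in> U" "w \<in> W" "y = u' + w'" "u' \<in> U" "w' \<in> W"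
      using x y by (auto elim!: set_plus_elim)
    moreover from this have "x + y = (u + u') + (w + w')" by simp
    ultimately show ?thesis
      using complex_vector.subspace_add[OF U] complex_vector.subspace_add[OF W]
      by (metis set_plus_intro)
  qed
  show "c *\<^sub>C x \<in> U + W" if x: "x \<in> U + W" for c x
    using x complex_vector.subspace_scale[OF U] complex_vector.subspace_scale[OF W]
    by (auto elim!: set_plus_elim simp: scaleC_add_right intro!: set_plus_intro)
qed

lemma subset_set_plus:
  fixes U W :: "'v::complex_vector set"
  assumes "csubspace U" "csubspace W"
  shows "U \<subseteq> U + W" "W \<subseteq> U + W"
  using set_plus_intro[OF _ complex_vector.subspace_0[OF assms(2)]]
    set_plus_intro[OF complex_vector.subspace_0[OF assms(1)]] by force+

lemma cspan_union_plus: "cspan (X \<union> Y) = cspan X + cspan Y"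
proof
  have "X \<union> Y \<subseteq> cspan X + cspan Y"
    using subset_set_plus[of "cspan X" "cspan Y"] complex_vector.span_superset[of X]
      complex_vector.span_superset[of Y] complex_vector.subspace_span by blast
  then show "cspan (X \<union> Y) \<subseteq> cspan X + cspan Y"
    by (intro complex_vector.span_minimal csubspace_plus) simp_all
  show "cspan X + cspan Y \<subseteq> cspan (X \<union> Y)"
  proof
    fix z assume "z \<in> cspan X + cspan Y"
    then obtain x y where "z = x + y" "x \<in> cspan X" "y \<in> cspan Y"
      by (rule set_plus_elim)
    then show "z \<in> cspan (X \<union> Y)"
      using complex_vector.span_mono[of X "X \<union> Y"] complex_vector.span_mono[of Y "X \<union> Y"]
      by (auto intro: complex_vector.span_add)
  qed
qed

section \<open>Bases and extremal subspaces in finite dimension\<close>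

lemma finite_dim_basis:
  assumes "finite_dim TYPE('v::complex_vector)"
  obtains B :: "'v::complex_vector set" where "finite B" "\<not> complex_vector.dependent B" "cspan B = UNIV"
proof -
  obtain B0 :: "'v set" where B0: "finite B0" "cspan B0 = UNIV"
    using assms by (auto simp: finite_dim_def)
  obtain B where "B \<subseteq> B0" "\<not> complex_vector.dependent B" "B0 \<subseteq> cspan B"
    using complex_vector.maximal_independent_subset[of B0] by blast
  moreover from this have "cspan B = UNIV"
    using B0(2) complex_vector.span_minimal[of B0 "cspan B"] by auto
  ultimately show ?thesis
    using that B0(1) finite_subset by blast
qed

lemma finite_dim_subspace_eq:
  assumes fd: "finite_dim TYPE('v::complex_vector)"
    and "csubspace U" "csubspace W" "U \<subseteq> (W :: 'v set)"
    and "complex_vector.dim W \<le> complex_vector.dim U"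
  shows "U = W"
proof -
  obtain B :: "'v set" where "finite B" "\<not> complex_vector.dependent B" "cspan B = UNIV"
    using finite_dim_basis[OF fd] .
  then interpret finite_dimensional_vector_space "scaleC :: complex \<Rightarrow> 'v \<Rightarrow> 'v" B
    rewrites "module.subspace scaleC = csubspace"
    by unfold_locales (auto simp: csubspace_def cspan_def)
  show ?thesis
    using assms subspace_dim_equal by blast
qed

text \<open>A member of least dimension works. This is the descending chain condition, used for
  centroid-invariant subspaces and for the images of the powers of an algebra element.\<close>

lemma finite_dim_minimal_subspace:
  assumes fd: "finite_dim TYPE('v::complex_vector)"
    and "Q (U0 :: 'v::complex_vector set)" and sub: "\<And>U. Q U \<Longrightarrow> csubspace U"
  obtains U where "Q U" "\<And>W. Q W \<Longrightarrow> W \<subseteq> U \<Longrightarrow> W = U"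
proof -
  obtain U where "Q U" "\<And>W. Q W \<Longrightarrow> complex_vector.dim U \<le> complex_vector.dim W"
    using exists_least_iff[of "\<lambda>n. \<exists>U. Q U \<and> complex_vector.dim U = n"] assms(2)
    by (metis not_le_imp_less)
  then show ?thesis
    using that finite_dim_subspace_eq[OF fd] sub by blast
qed

lemma finite_dim_dim_le:
  assumes fd: "finite_dim TYPE('v::complex_vector)"
  obtains n where "\<And>U :: 'v set. complex_vector.dim U \<le> n"
proof -
  obtain B :: "'v set" where "finite B" "\<not> complex_vector.dependent B" "cspan B = UNIV"
    using finite_dim_basis[OF fd] .
  then interpret finite_dimensional_vector_space "scaleC :: complex \<Rightarrow> 'v \<Rightarrow> 'v" B
    by unfold_locales (auto simp: csubspace_def cspan_def)
  show ?thesis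
    using that dim_subset_UNIV by blast
qed

text \<open>Dimensions are bounded, so a member of greatest dimension exists. This makes the socle
  series stop and replaces Zorn's lemma when a proper ideal is enlarged to a maximal one.\<close>

lemma finite_dim_maximal_subspace:
  assumes fd: "finite_dim TYPE('v::complex_vector)"
    and "Q (U0 :: 'v::complex_vector set)" and sub: "\<And>U. Q U \<Longrightarrow> csubspace U"
  obtains U where "Q U" "\<And>W. Q W \<Longrightarrow> U \<subseteq> W \<Longrightarrow> W = U"
proof -
  obtain n where n: "\<And>U :: 'v set. complex_vector.dim U \<le> n"
    using finite_dim_dim_le[OF fd] by blast
  obtain U where "Q U" "\<And>W. Q W \<Longrightarrow> complex_vector.dim W \<le> complex_vector.dim U"
    using ex_has_greatest_nat[of Q U0 complex_vector.dim "Suc n"] assms(2) n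
    by (auto simp: less_Suc_eq_le)
  then show ?thesis
    using that finite_dim_subspace_eq[OF fd] sub by metis
qed

lemma clinear_representation:
  assumes "\<not> complex_vector.dependent B" "cspan B = UNIV"
  shows "clinear (\<lambda>v. complex_vector.representation B v b)"
  by (rule clinearI) (use assms in \<open>simp_all add: complex_vector.representation_add
      complex_vector.representation_scale scaleC_complex_def\<close>)

lemma sum_representation:
  assumes "finite B" "\<not> complex_vector.dependent B" "cspan B = UNIV"
  shows "(\<Sum>b\<in>B. complex_vector.representation B v b *\<^sub>C b) = v"
  by (rule complex_vector.sum_representation_eq) (use assms in auto)

lemma clinear_sum:
  assumes "clinear f"
  shows "f (\<Sum>i\<in>I. g i) = (\<Sum>i\<in>I. f (g i))"
  by (induction I rule: infinite_finite_induct)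
    (simp_all add: clinear_zero[OF assms] clinear_add[OF assms])

section \<open>Composition, matrix units and polynomials in an endomorphism\<close>

lift_definition endo_comp :: "'v::complex_vector endo \<Rightarrow> 'v endo \<Rightarrow> 'v endo" (infixl "\<odot>" 70)
  is "\<lambda>S T x. S (T x)"
  by (rule clinear_compose)

lift_definition endo_id :: "'v::complex_vector endo" is "\<lambda>x. x"
  by (rule clinearI) simp_all

lemma app_simps [simp]:
  "app 0 x = 0" "app (S + T) x = app S x + app T x" "app (S - T) x = app S x - app T x"
  "app (- S) x = - app S x" "app (c *\<^sub>C S) x = c *\<^sub>C app S x" "app (S \<odot> T) x = app S (app T x)"
  "app endo_id x = x" "app (lie S T) x = app S (app T x) - app T (app S x)"
  by (simp_all add: zero_endo.rep_eq plus_endo.rep_eq minus_endo.rep_eq uminus_endo.rep_eq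
      scaleC_endo.rep_eq endo_comp.rep_eq endo_id.rep_eq lie_endo.rep_eq)

lemma app_mult_endo [simp]: "app (mult_endo a) b = a * b"
  by (simp add: mult_endo.rep_eq)

lemma clinear_app_left: "clinear (\<lambda>T. app T x)"
  by (rule clinearI) simp_all

lemma app_sum [simp]: "app (\<Sum>i\<in>I. g i) x = (\<Sum>i\<in>I. app (g i) x)"
  by (rule clinear_sum[OF clinear_app_left])

lemma app_sum_right: "app T (\<Sum>i\<in>I. g i) = (\<Sum>i\<in>I. app T (g i))"
  by (rule clinear_sum[OF clinear_app])

lemma lie_conv_comp: "lie S T = S \<odot> T - T \<odot> S"
  by (rule endo_eqI) simp

text \<open>For coordinate functionals \<open>f\<close> and basis vectors \<open>w\<close> these are
  the matrix units. The value 0 for a nonlinear \<open>f\<close> keeps the result an endomorphism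
  for every argument.\<close>

lift_definition rank_one :: "('v::complex_vector \<Rightarrow> complex) \<Rightarrow> 'v \<Rightarrow> 'v endo"
  is "\<lambda>f w v. if clinear f then f v *\<^sub>C w else 0"
  by (rule clinearI) (auto simp: clinear_add clinear_scale scaleC_add_left scaleC_scaleC scaleC_complex_def)

lemma app_rank_one [simp]: "clinear f \<Longrightarrow> app (rank_one f w) v = f v *\<^sub>C w"
  by (simp add: rank_one.rep_eq)

lemma finite_dim_endo:
  assumes "finite_dim TYPE('v::complex_vector)"
  shows "finite_dim TYPE('v::complex_vector endo)"
proof -
  obtain B :: "'v set" where B: "finite B" "\<not> complex_vector.dependent B" "cspan B = UNIV"
    using finite_dim_basis[OF assms] .
  define r where "r b v = complex_vector.representation B v b" for b v
  have lin: "clinear (r b)" for b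
    unfolding r_def by (rule clinear_representation[OF B(2,3)])
  have rep: "(\<Sum>b\<in>B. r b v *\<^sub>C b) = v" for v
    unfolding r_def by (rule sum_representation[OF B])
  define E where "E = (\<lambda>(b, c). rank_one (r b) c) ` (B \<times> B)"
  have "T \<in> cspan E" for T
  proof -
    \<comment> \<open>The coefficient is the matrix entry of \<open>T\<close> in column
      \<open>b\<close> and row \<open>c\<close>.\<close>
    have "T = (\<Sum>b\<in>B. \<Sum>c\<in>B. r c (app T b) *\<^sub>C rank_one (r b) c)"
    proof (rule endo_eqI)
      fix v
      have "app T v = (\<Sum>b\<in>B. r b v *\<^sub>C app T b)"
        using arg_cong[OF rep[of v], of "app T"] by (simp add: app_sum_right)
      also have "\<dots> = (\<Sum>b\<in>B. r b v *\<^sub>C (\<Sum>c\<in>B. r c (app T b) *\<^sub>C c))"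
        by (simp only: rep)
      also have "\<dots> = app (\<Sum>b\<in>B. \<Sum>c\<in>B. r c (app T b) *\<^sub>C rank_one (r b) c) v"
        by (simp add: lin complex_vector.scale_sum_right scaleC_scaleC mult.commute)
      finally show "app T v = app (\<Sum>b\<in>B. \<Sum>c\<in>B. r c (app T b) *\<^sub>C rank_one (r b) c) v" .
    qed
    also have "\<dots> \<in> cspan E"
      by (intro complex_vector.span_sum complex_vector.span_scale complex_vector.span_base)
        (auto simp: E_def)
    finally show ?thesis .
  qed
  then have "cspan E = UNIV" "finite E"
    using B(1) by (auto simp: E_def)
  then show ?thesis
    unfolding finite_dim_def by blast
qed

text \<open>\<open>peval T p\<close> is p(T), evaluated by the Horner scheme.\<close>

definition peval :: "'v::complex_vector endo \<Rightarrow> complex poly \<Rightarrow> 'v endo"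
  where "peval T p = fold_coeffs (\<lambda>c P. c *\<^sub>C endo_id + T \<odot> P) p 0"

lemma peval_0 [simp]: "peval T 0 = 0"
  by (simp add: peval_def)

lemma peval_pCons [simp]: "peval T (pCons c p) = c *\<^sub>C endo_id + T \<odot> peval T p"
proof -
  have "T \<odot> 0 = 0" by (rule endo_eqI) simp
  then show ?thesis
    by (cases "p = 0 \<and> c = 0") (auto simp: peval_def)
qed

lemma peval_add: "peval T (p + q) = peval T p + peval T q"
  by (induction p q rule: poly_induct2) (auto intro!: endo_eqI simp: scaleC_add_left)

lemma peval_smult: "peval T (smult c p) = c *\<^sub>C peval T p"
  by (induction p) (auto intro!: endo_eqI simp: scaleC_add_right scaleC_scaleC)

lemma peval_sum: "peval T (\<Sum>i\<in>I. f i) = (\<Sum>i\<in>I. peval T (f i))"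
  by (induction I rule: infinite_finite_induct) (simp_all add: peval_add)

lemma peval_monom: "peval T (monom c n) = c *\<^sub>C peval T (monom 1 n)"
  using peval_smult[of T c "monom 1 n"] by (simp add: smult_monom)

text \<open>The powers of \<open>T\<close> cannot be both distinct and linearly independent, because
  the space of endomorphisms is finite dimensional.\<close>

lemma annihilating_poly:
  fixes T :: "'v::complex_vector endo"
  assumes "finite_dim TYPE('v)"
  obtains p where "p \<noteq> 0" "peval T p = 0"
proof -
  define w where "w i = peval T (monom 1 i)" for i
  show ?thesis
  \<comment> \<open>Independence of the set \<open>range w\<close> does not notice a repetition
    among the powers, so a repetition is treated separately.\<close>
  proof (cases "inj w")
    case False
    then obtain i j where ij: "i \<noteq> j" "w i = w j" by (auto simp: inj_on_def)
    have "peval T (monom 1 i + smult (- 1) (monom 1 j)) = 0"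
      unfolding peval_add peval_smult using ij(2) by (simp add: w_def)
    moreover have "monom 1 i + smult (- 1) (monom 1 j) \<noteq> (0 :: complex poly)"
      using ij(1) by (metis coeff_0 coeff_add coeff_monom coeff_smult mult_zero_right add_0_right zero_neq_one)
    ultimately show ?thesis using that by blast
  next
    case True
    obtain B :: "'v endo set" where B: "finite B" "cspan B = UNIV"
      using finite_dim_endo[OF assms] unfolding finite_dim_def by blast
    have "infinite (range w)"
      using True finite_imageD by blast
    then have "complex_vector.dependent (range w)"
      using complex_vector.independent_span_bound[OF B(1), of "range w"] B(2) by auto
    then obtain t u where t: "finite t" "t \<subseteq> range w" "(\<Sum>v\<in>t. u v *\<^sub>C v) = 0" "\<exists>v\<in>t. u v \<noteq> 0"
      unfolding complex_vector.dependent_explicit by blast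
    obtain I where I: "t = w ` I" "finite I"
      using t(1,2) by (metis finite_subset_image)
    define p where "p = (\<Sum>i\<in>I. monom (u (w i)) i)"
    have "peval T p = (\<Sum>i\<in>I. u (w i) *\<^sub>C w i)"
      unfolding p_def peval_sum by (simp add: peval_monom[of _ "u _"] w_def)
    also have "\<dots> = 0"
      using t(3) True unfolding I(1) by (subst (asm) sum.reindex) (auto simp: inj_on_def)
    finally have "peval T p = 0" .
    moreover have "p \<noteq> 0"
    proof -
      obtain i where i: "i \<in> I" "u (w i) \<noteq> 0" using t(4) I(1) by auto
      have "coeff p i = u (w i)"
        using i(1) I(2) by (simp add: p_def coeff_sum sum.delta)
      then show ?thesis using i(2) by auto
    qed
    ultimately show ?thesis using that by blast
  qed
qed

text \<open>A lemma of Jacobson: among the nonzero polynomials \<open>p\<close> with \<open>p(T) X^m = 0\<close> for some \<open>m\<close>, where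
  \<open>X = [D, T]\<close>, one of least degree is constant, because commuting with \<open>D\<close> replaces \<open>p\<close> by its
  derivative at the cost of raising \<open>m\<close>.\<close>

lemma commutator_nilpotent_on:
  fixes D T :: "'v::complex_vector endo"
  assumes fd: "finite_dim TYPE('v)" and P: "csubspace P"
    and DP: "\<And>x. x \<in> P \<Longrightarrow> app D x \<in> P"
    and CP: "\<And>T x. T \<in> C \<Longrightarrow> x \<in> P \<Longrightarrow> app T x \<in> P"
    and DC: "\<And>T. T \<in> C \<Longrightarrow> lie D T \<in> C"
    and comm: "\<And>T T' x. T \<in> C \<Longrightarrow> T' \<in> C \<Longrightarrow> x \<in> P \<Longrightarrow> app T (app T' x) = app T' (app T x)"
    and T: "T \<in> C"
  obtains m where "\<And>x. x \<in> P \<Longrightarrow> (app (lie D T) ^^ m) x = 0"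
proof -
  define X where "X = lie D T"
  define X' where "X' = lie D X"
  have C: "X \<in> C" "X' \<in> C"
    using T DC by (auto simp: X_def X'_def)
  have pP: "app (peval T p) x \<in> P" if "x \<in> P" for p x
    using that by (induction p)
      (auto simp: complex_vector.subspace_0[OF P] intro!: complex_vector.subspace_add[OF P]
        complex_vector.subspace_scale[OF P] CP T)
  have XP: "(app X ^^ m) x \<in> P" if "x \<in> P" for m x
    using that C(1) by (induction m) (auto intro: CP)
  have pcomm: "app Y (app (peval T p) x) = app (peval T p) (app Y x)" if "Y \<in> C" "x \<in> P" for Y p x
    by (induction p) (use that in \<open>simp_all add: comm[OF that(1) T] pP\<close>)
  have DT: "app D (app T x) = app T (app D x) + app X x" for x
    by (simp add: X_def)
  have DX: "app D (app X x) = app X (app D x) + app X' x" for x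
    by (simp add: X'_def)
  \<comment> \<open>Leibniz rule for p(T): as \<open>X\<close> commutes with \<open>T\<close> on
    \<open>P\<close>, moving \<open>D\<close> past p(T) costs p'(T) X.\<close>
  have Dp: "app D (app (peval T p) x) = app (peval T p) (app D x) + app (peval T (pderiv p)) (app X x)"
    if x: "x \<in> P" for p x
  proof (induction p)
    case (pCons c p)
    then show ?case
      by (simp add: pderiv_pCons peval_add DT pcomm[OF C(1) x] algebra_simps)
  qed simp
  \<comment> \<open>The usual correction term m X' X^(m-1) becomes m X' X^m through the additional
    \<open>X\<close> in front, so m = 0 is no exception.\<close>
  have DXm: "app X (app D ((app X ^^ m) x))
      = (app X ^^ Suc m) (app D x) + of_nat m *\<^sub>C app X' ((app X ^^ m) x)" if x: "x \<in> P" for m x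
  proof (induction m)
    case (Suc m)
    have "app X (app D ((app X ^^ Suc m) x))
        = app X (app X (app D ((app X ^^ m) x))) + app X (app X' ((app X ^^ m) x))"
      by (simp add: DX)
    also have "app X (app X' ((app X ^^ m) x)) = app X' ((app X ^^ Suc m) x)"
      using comm[OF C XP[OF x]] by simp
    also have "app X (app X (app D ((app X ^^ m) x)))
        = (app X ^^ Suc (Suc m)) (app D x) + of_nat m *\<^sub>C app X (app X' ((app X ^^ m) x))"
      by (simp only: Suc) simp
    also have "app X (app X' ((app X ^^ m) x)) = app X' ((app X ^^ Suc m) x)"
      using comm[OF C XP[OF x]] by simp
    finally show ?case
      by (simp add: scaleC_add_left scaleC_one add.assoc add.commute)
  qed simp
  \<comment> \<open>Of the two new factors \<open>X\<close>, one comes from \<open>Dp\<close> and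
    one is the \<open>X\<close> in front in \<open>DXm\<close>. All other terms vanish because p(T)
    X^m is zero on \<open>P\<close>.\<close>
  have step: "app (peval T (pderiv p)) ((app X ^^ (m + 2)) x) = 0"
    if p: "\<And>x. x \<in> P \<Longrightarrow> app (peval T p) ((app X ^^ m) x) = 0" and x: "x \<in> P" for p m x
  proof -
    let ?y = "(app X ^^ m) x"
    have y: "?y \<in> P" "app X ?y \<in> P" "app D ?y \<in> P"
      using XP[OF x] C by (auto intro: CP DP)
    have "0 = app X (app D (app (peval T p) ?y))"
      using p[OF x] by simp
    also have "\<dots> = app (peval T p) (app X (app D ?y)) + app (peval T (pderiv p)) (app X (app X ?y))"
      by (simp add: Dp[OF y(1)] pcomm[OF C(1)] y)
    also have "app (peval T p) (app X (app D ?y)) = 0"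
    proof -
      have "app (peval T p) ((app X ^^ Suc m) (app D x)) = app X (app (peval T p) ((app X ^^ m) (app D x)))"
        by (simp add: pcomm[OF C(1) XP[OF DP[OF x]]])
      then have "app (peval T p) ((app X ^^ Suc m) (app D x)) = 0"
        using p[OF DP[OF x]] by simp
      moreover have "app (peval T p) (app X' ?y) = 0"
        using p[OF x] by (simp flip: pcomm[OF C(2) y(1)])
      ultimately show ?thesis
        unfolding DXm[OF x] by simp
    qed
    finally show ?thesis by simp
  qed
  have "\<exists>m. \<forall>x\<in>P. (app X ^^ m) x = 0"
    if "p \<noteq> 0" "\<forall>x\<in>P. app (peval T p) ((app X ^^ m) x) = 0" for p m
    using that
  proof (induction "degree p" arbitrary: p m rule: less_induct)
    case less
    show ?case
    proof (cases "degree p = 0")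
      case True
      then obtain c where "p = [:c:]" by (metis degree_eq_zeroE)
      then have "\<forall>x\<in>P. (app X ^^ m) x = 0"
        using less.prems by simp
      then show ?thesis by blast
    next
      case False
      then have "degree (pderiv p) < degree p" "pderiv p \<noteq> 0"
        by (simp_all add: degree_pderiv pderiv_eq_0_iff)
      then show ?thesis
        using less.hyps[of "pderiv p" "m + 2"] step[of p m] less.prems(2) by blast
    qed
  qed
  then obtain m where "\<forall>x\<in>P. (app X ^^ m) x = 0"
    using annihilating_poly[OF fd, of T] by (metis app_simps(1))
  then show ?thesis
    using that X_def by blast
qed

section \<open>Lie algebras: solvability, centroid and socle series\<close>

lemma lie_zero [simp]: "lie 0 x = 0" "lie x 0 = (0 :: 'g::lie_algebra)"
  using lie_scale_left[of 0 0 x] lie_scale_right[of x 0 0] by simp_all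

lemma csubspace_lie_product: "csubspace (lie_product U V)"
  by (simp add: lie_product_def)

lemma lie_in_lie_product: "x \<in> U \<Longrightarrow> y \<in> V \<Longrightarrow> lie x y \<in> lie_product U V"
  unfolding lie_product_def by (rule complex_vector.span_base) blast

lemma lie_product_minimal:
  assumes "csubspace W" "\<And>x y. x \<in> U \<Longrightarrow> y \<in> V \<Longrightarrow> lie x y \<in> W"
  shows "lie_product U V \<subseteq> W"
  unfolding lie_product_def by (rule complex_vector.span_minimal) (use assms in auto)

lemma lie_product_mono: "U \<subseteq> U' \<Longrightarrow> V \<subseteq> V' \<Longrightarrow> lie_product U V \<subseteq> lie_product U' V'"
  by (rule lie_product_minimal[OF csubspace_lie_product]) (auto intro: lie_in_lie_product)

lemma lie_ideal_lie_right:
  assumes "lie_ideal I L" "x \<in> I" "y \<in> L"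
  shows "lie x y \<in> I"
  using assms lie_anticomm[of x y] complex_vector.subspace_neg[of I "lie y x"]
  by (auto simp: lie_ideal_def)

lemma lie_subalgebra_ideal: "lie_ideal I L \<Longrightarrow> lie_subalgebra I"
  by (auto simp: lie_ideal_def lie_subalgebra_def)

lemma csubspace_derived_series: "csubspace L \<Longrightarrow> csubspace (derived_series n L)"
  by (cases n) (simp_all add: csubspace_lie_product)

lemma zero_in_derived_series: "csubspace L \<Longrightarrow> 0 \<in> derived_series n L"
  by (rule complex_vector.subspace_0[OF csubspace_derived_series])

lemma derived_series_mono: "L \<subseteq> M \<Longrightarrow> derived_series n L \<subseteq> derived_series n M"
  by (induction n) (simp_all add: lie_product_mono)

lemma derived_series_add: "derived_series (m + n) L = derived_series m (derived_series n L)"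
  by (induction m) simp_all

lemma derived_series_subset: "lie_subalgebra L \<Longrightarrow> derived_series n L \<subseteq> L"
proof (induction n)
  case (Suc n)
  then have "lie_product (derived_series n L) (derived_series n L) \<subseteq> lie_product L L"
    by (intro lie_product_mono) auto
  also have "\<dots> \<subseteq> L"
    using Suc.prems by (intro lie_product_minimal) (auto simp: lie_subalgebra_def)
  finally show ?case by simp
qed simp

lemma lie_solvable_subset:
  assumes "lie_subalgebra L" "L \<subseteq> M" "lie_solvable M"
  shows "lie_solvable L"
proof -
  obtain n where "derived_series n M = {0}"
    using assms(3) by (auto simp: lie_solvable_def)
  then have "derived_series n L \<subseteq> {0}"
    using derived_series_mono[OF assms(2), of n] by simp
  moreover have "0 \<in> derived_series n L"
    using assms(1) by (auto simp: lie_subalgebra_def intro: zero_in_derived_series)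
  ultimately show ?thesis
    using assms(1) by (auto simp: lie_solvable_def)
qed

lemma derived_series_into_solvable:
  assumes "lie_subalgebra L" "derived_series n L \<subseteq> M" "derived_series m M \<subseteq> {0}"
  shows "lie_solvable L"
proof -
  have "derived_series (m + n) L \<subseteq> {0}"
    using derived_series_mono[OF assms(2), of m] assms(3) by (auto simp: derived_series_add)
  moreover have "0 \<in> derived_series (m + n) L"
    using assms(1) by (auto simp: lie_subalgebra_def intro: zero_in_derived_series)
  ultimately show ?thesis
    using assms(1) unfolding lie_solvable_def by blast
qed

lemma lie_ideal_plus:
  assumes "lie_ideal I L" "lie_ideal J L" "lie_subalgebra L"
  shows "lie_ideal (I + J) L"
proof -
  have "lie x y \<in> I + J" if "x \<in> L" "y \<in> I + J" for x y
    using that assms(1,2) by (auto simp: lie_ideal_def lie_add_right elim!: set_plus_elim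
        intro!: set_plus_intro)
  moreover have "I + J \<subseteq> L"
    using assms by (auto simp: lie_ideal_def lie_subalgebra_def elim!: set_plus_elim
        intro: complex_vector.subspace_add)
  ultimately show ?thesis
    using assms by (simp add: lie_ideal_def csubspace_plus)
qed

text \<open>Modulo \<open>J\<close> the derived series of the sum is that of \<open>I\<close>; once
  it has entered \<open>J\<close>, the derived series of \<open>J\<close> finishes.\<close>

lemma lie_solvable_plus:
  assumes I: "lie_ideal I L" "lie_solvable I" and J: "lie_ideal J L" "lie_solvable J"
    and L: "lie_subalgebra L"
  shows "lie_solvable (I + J)"
proof -
  obtain m n where mn: "derived_series m I = {0}" "derived_series n J = {0}"
    using I(2) J(2) by (auto simp: lie_solvable_def)
  have sub: "csubspace I" "csubspace J" "I \<subseteq> L" "J \<subseteq> L"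
    using I J by (auto simp: lie_ideal_def)
  have "derived_series k (I + J) \<subseteq> derived_series k I + J" for k
  proof (induction k)
    case (Suc k)
    have "lie_product (derived_series k (I + J)) (derived_series k (I + J)) \<subseteq> derived_series (Suc k) I + J"
    proof (rule lie_product_minimal)
      show "csubspace (derived_series (Suc k) I + J)"
        by (simp add: csubspace_plus csubspace_lie_product sub)
      fix x y assume "x \<in> derived_series k (I + J)" "y \<in> derived_series k (I + J)"
      then have "x \<in> derived_series k I + J" "y \<in> derived_series k I + J"
        using Suc by auto
      then obtain a i b j where xy: "x = a + i" "y = b + j" and ab: "a \<in> derived_series k I"
        "b \<in> derived_series k I" and ij: "i \<in> J" "j \<in> J"
        by (auto elim!: set_plus_elim)
      have "a \<in> L" "y \<in> L"
        using ab ij derived_series_subset[of I k] lie_subalgebra_ideal[OF I(1)] sub L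
        by (auto simp: xy(2) lie_subalgebra_def intro!: complex_vector.subspace_add)
      then have "lie a j + lie i y \<in> J"
        using J(1) ij lie_ideal_lie_right[OF J(1)]
        by (auto simp: lie_ideal_def intro!: complex_vector.subspace_add)
      moreover have "lie x y = lie a b + (lie a j + lie i y)"
        by (simp add: xy lie_add_left lie_add_right algebra_simps)
      moreover have "lie a b \<in> derived_series (Suc k) I"
        using ab by (simp add: lie_in_lie_product)
      ultimately show "lie x y \<in> derived_series (Suc k) I + J"
        by (metis set_plus_intro)
    qed
    then show ?case by simp
  qed simp
  then have "derived_series m (I + J) \<subseteq> J"
    using mn(1) by (force elim!: set_plus_elim)
  then show ?thesis
    using derived_series_into_solvable[OF lie_subalgebra_ideal[OF lie_ideal_plus[OF I(1) J(1) L]]] mn(2)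
    by blast
qed

text \<open>For a solvable ideal \<open>J\<close> of \<open>L\<close>, the intersection of
  \<open>J + I\<close> with \<open>P\<close> is a solvable ideal of \<open>P\<close>, hence zero. It
  contains the \<open>P\<close>-component of every element of \<open>J\<close>.\<close>

lemma is_lie_radical_complement:
  assumes L: "lie_subalgebra L" and I: "lie_ideal I L" "lie_solvable I"
    and P: "lie_semisimple P" "P \<subseteq> L" "L \<subseteq> P + I"
  shows "is_lie_radical I L"
proof -
  have sub: "csubspace P" "lie_subalgebra P" "csubspace I"
    using P(1) I(1) by (auto simp: lie_semisimple_def lie_subalgebra_def lie_ideal_def)
  have "J \<subseteq> I" if J: "lie_ideal J L" "lie_solvable J" for J
  proof
    fix x assume x: "x \<in> J"
    define H where "H = (J + I) \<inter> P"
    have JI: "lie_ideal (J + I) L" and JIs: "lie_solvable (J + I)"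
      using lie_ideal_plus[OF J(1) I(1) L] lie_solvable_plus[OF J I L] by auto
    have H: "lie_ideal H P"
      using JI sub P(2) by (auto simp: H_def lie_ideal_def lie_subalgebra_def
          intro: complex_vector.subspace_inter)
    then have "lie_solvable H"
      by (rule lie_solvable_subset[OF lie_subalgebra_ideal _ JIs]) (simp add: H_def)
    then have H0: "H \<subseteq> {0}"
      using P(1) H by (auto simp: lie_semisimple_def is_lie_radical_def)
    have "x \<in> P + I"
      using x J(1) P(3) by (auto simp: lie_ideal_def)
    then obtain p i where pi: "x = p + i" "p \<in> P" "i \<in> I"
      by (rule set_plus_elim)
    have "p = x + (- i)" "- i \<in> I"
      using pi sub(3) by (simp_all add: complex_vector.subspace_neg)
    then have "p \<in> J + I"
      using x by (metis set_plus_intro)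
    then show "x \<in> I"
      using H0 pi by (auto simp: H_def)
  qed
  then show ?thesis
    using I by (simp add: is_lie_radical_def)
qed

section \<open>Derivations, centroid and central homomorphisms\<close>

lemma csubspace_derivations: "csubspace (lie_derivations :: 'g::lie_algebra endo set)"
  by (rule csubspaceI) (auto simp: lie_derivations_def lie_add_left lie_add_right lie_scale_left
      lie_scale_right scaleC_add_right)

lemma lie_diff_distrib: "lie (x - y) z = lie x z - lie y (z :: 'g::lie_algebra)"
    "lie z (x - y) = lie z x - lie z y"
  using lie_add_left[of "x - y" y z] lie_add_right[of z "x - y" y] by (simp_all add: algebra_simps)

lemma lie_subalgebra_derivations: "lie_subalgebra (lie_derivations :: 'g::lie_algebra endo set)"
  unfolding lie_subalgebra_def
proof (intro conjI ballI csubspace_derivations)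
  fix D E :: "'g endo" assume "D \<in> lie_derivations" "E \<in> lie_derivations"
  then show "lie D E \<in> lie_derivations"
    by (auto simp: lie_derivations_def lie_diff_distrib lie_add_left lie_add_right)
qed

lemma derivation_lie: "D \<in> lie_derivations \<Longrightarrow> app D (lie x y) = lie (app D x) y + lie x (app D y)"
  by (simp add: lie_derivations_def)

lemma centroid_right: "T \<in> centroid \<Longrightarrow> lie x (app T y) = app T (lie x y)"
  by (auto simp: centroid_def fun_eq_iff)

lemma centroid_left: "T \<in> centroid \<Longrightarrow> lie (app T x) y = app T (lie x y)"
  by (metis centroid_right lie_anticomm app_minus)

lemma centroidI:
  assumes "\<And>x y. lie x (app T y) = app T (lie x y)"
  shows "T \<in> centroid"
  using assms by (simp add: centroid_def fun_eq_iff)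

lemma csubspace_centroid: "csubspace (centroid :: 'g::lie_algebra endo set)"
  by (rule csubspaceI)
    (auto intro!: centroidI simp: centroid_right lie_add_right lie_scale_right)

lemma centroid_comp: "T \<in> centroid \<Longrightarrow> T' \<in> centroid \<Longrightarrow> T \<odot> T' \<in> centroid"
  by (auto intro!: centroidI simp: centroid_right)

lemma lie_derivation_centroid:
  assumes D: "D \<in> lie_derivations" and T: "T \<in> centroid"
  shows "lie D T \<in> centroid"
proof (rule centroidI)
  fix x y
  have "app D (app T (lie x y)) = lie (app D x) (app T y) + lie x (app D (app T y))"
    using derivation_lie[OF D, of x "app T y"] by (simp add: centroid_right[OF T])
  moreover have "app T (app D (lie x y)) = lie (app D x) (app T y) + lie x (app T (app D y))"
    by (simp add: derivation_lie[OF D] centroid_right[OF T])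
  ultimately show "lie x (app (lie D T) y) = app (lie D T) (lie x y)"
    by (simp add: lie_diff_distrib)
qed

lemma centroid_comp_derivation:
  assumes "T \<in> centroid" "D \<in> lie_derivations"
  shows "T \<odot> D \<in> lie_derivations"
  using assms by (simp add: lie_derivations_def centroid_left centroid_right)

lemma csubspace_center: "csubspace (lie_center :: 'g::lie_algebra set)"
  by (rule csubspaceI) (auto simp: lie_center_def lie_add_right lie_scale_right)

lemma centroid_center: "T \<in> centroid \<Longrightarrow> z \<in> lie_center \<Longrightarrow> app T z \<in> lie_center"
  by (simp add: lie_center_def centroid_right)

lemma derivation_center:
  assumes "D \<in> lie_derivations" "z \<in> lie_center"
  shows "app D z \<in> lie_center"
  using assms derivation_lie[OF assms(1), of _ z] by (simp add: lie_center_def)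

lemma derivation_commutators:
  assumes D: "D \<in> lie_derivations" and x: "x \<in> lie_product UNIV UNIV"
  shows "app D x \<in> lie_product UNIV UNIV"
  by (rule cspan_linear_mem[OF clinear_app csubspace_lie_product x[unfolded lie_product_def]])
    (auto simp: derivation_lie[OF D] intro!: complex_vector.subspace_add csubspace_lie_product
      lie_in_lie_product)

lemma centroid_commutators:
  assumes T: "T \<in> centroid" and x: "x \<in> lie_product UNIV UNIV"
  shows "app T x \<in> lie_product UNIV UNIV"
  by (rule cspan_linear_mem[OF clinear_app csubspace_lie_product x[unfolded lie_product_def]])
    (auto intro!: lie_in_lie_product simp flip: centroid_right[OF T])

lemma csubspace_eq: "clinear f \<Longrightarrow> clinear g \<Longrightarrow> csubspace {x. f x = g x}"
  by (rule csubspaceI) (simp_all add: clinear_zero clinear_add clinear_scale)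

text \<open>A centroid element may be moved to either entry of a bracket, so both composites send
  [x, y] to [T x, T' y].\<close>

lemma centroid_commute_on_commutators:
  assumes T: "T \<in> centroid" "T' \<in> centroid" and x: "x \<in> lie_product UNIV UNIV"
  shows "app T (app T' x) = app T' (app T x)"
proof -
  have "lie_product UNIV UNIV \<subseteq> {x. app (T \<odot> T') x = app (T' \<odot> T) x}"
  proof (rule lie_product_minimal)
    show "csubspace {x. app (T \<odot> T') x = app (T' \<odot> T) x}"
      by (rule csubspace_eq; rule clinear_app)
    show "lie x y \<in> {x. app (T \<odot> T') x = app (T' \<odot> T) x}" for x y
      by (simp flip: centroid_right[OF T(2)] centroid_left[OF T(1)])
  qed
  then show ?thesis using x by auto
qed

text \<open>[x, T y] = T [x, y] = 0 puts every value of \<open>T\<close> in the center.\<close>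

lemma centroid_kills_commutators:
  assumes T: "T \<in> centroid" and 0: "\<And>x y. app T (lie x y) = 0"
  shows "T \<in> central_homs"
proof -
  have "lie_product UNIV UNIV \<subseteq> {x. app T x \<in> {0}}"
    by (rule lie_product_minimal, rule csubspace_vimage) (simp_all add: 0)
  then show ?thesis
    using 0 by (auto simp: central_homs_def lie_center_def centroid_right[OF T])
qed

lemma central_homs_into_center: "T \<in> central_homs \<Longrightarrow> app T x \<in> lie_center"
  by (auto simp: central_homs_def)

lemma central_homs_commutators: "T \<in> central_homs \<Longrightarrow> x \<in> lie_product UNIV UNIV \<Longrightarrow> app T x = 0"
  by (simp add: central_homs_def)

text \<open>The commutator lies in the centroid and vanishes on brackets. Commutativity thus fails
  only by maps into the center, an error that every term of the socle series absorbs.\<close>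

lemma lie_centroid_central:
  assumes T: "T \<in> centroid" "T' \<in> centroid"
  shows "lie T T' \<in> central_homs"
proof (rule centroid_kills_commutators)
  show "lie T T' \<in> centroid"
    unfolding lie_conv_comp
    by (intro complex_vector.subspace_diff csubspace_centroid centroid_comp T)
qed (simp add: centroid_commute_on_commutators[OF T] lie_in_lie_product)

lemma central_homs_centroid: "(central_homs :: 'g::lie_algebra endo set) \<subseteq> centroid"
proof
  fix T :: "'g endo" assume T: "T \<in> central_homs"
  have "lie x (app T y) = 0" for x y
    using central_homs_into_center[OF T, of y] by (simp add: lie_center_def)
  then show "T \<in> centroid"
    by (intro centroidI) (simp add: central_homs_commutators[OF T] lie_in_lie_product)
qed

lemma central_homs_comp:
  assumes K: "K \<in> central_homs"
  shows "\<lbrakk>\<And>x. x \<in> lie_product UNIV UNIV \<Longrightarrow> app F x \<in> lie_product UNIV UNIV\<rbrakk> \<Longrightarrow> K \<odot> F \<in> central_homs"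
    and "\<lbrakk>\<And>x. x \<in> lie_center \<Longrightarrow> app F x \<in> lie_center\<rbrakk> \<Longrightarrow> F \<odot> K \<in> central_homs"
  using K by (auto simp: central_homs_def image_subset_iff)

section \<open>The socle series and the derivations that lower it\<close>

definition nil_centroid :: "'g::lie_algebra endo set"
  where "nil_centroid = {T \<in> centroid. \<exists>n. \<forall>x. (app T ^^ n) x = 0}"

lemma nil_centroid_centroid: "T \<in> nil_centroid \<Longrightarrow> T \<in> centroid"
  by (simp add: nil_centroid_def)

text \<open>\<open>commutator_nilpotent_on\<close> applies on the derived algebra, where the
  centroid is commutative. If X^m vanishes there, then [y, X^m x] = X^m [y, x] = 0, so X^m maps into
  the center. The center lies in the derived algebra, so a second X^m gives zero.\<close>

lemma lie_derivation_nil_centroid: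
  fixes D T :: "'g::lie_algebra endo"
  assumes fd: "finite_dim TYPE('g)" and center: "(lie_center :: 'g set) \<subseteq> lie_product UNIV UNIV"
    and D: "D \<in> lie_derivations" and T: "T \<in> centroid"
  shows "lie D T \<in> nil_centroid"
proof -
  define X where "X = lie D T"
  have X: "X \<in> centroid"
    unfolding X_def by (rule lie_derivation_centroid[OF D T])
  have Xn: "lie y ((app X ^^ n) x) = (app X ^^ n) (lie y x)" for n x y
    by (induction n) (simp_all add: centroid_right[OF X])
  obtain m where m: "\<And>x. x \<in> lie_product UNIV UNIV \<Longrightarrow> (app X ^^ m) x = 0"
    unfolding X_def
    by (rule commutator_nilpotent_on[OF fd csubspace_lie_product, of _ _ D centroid T])
      (auto intro: derivation_commutators[OF D] centroid_commutators lie_derivation_centroid[OF D]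
        centroid_commute_on_commutators T)
  have "(app X ^^ m) x \<in> lie_center" for x
    by (simp add: lie_center_def Xn m lie_in_lie_product)
  then have "(app X ^^ (m + m)) x = 0" for x
    using center m by (auto simp: funpow_add)
  then show ?thesis
    using X unfolding X_def nil_centroid_def by blast
qed

text \<open>An ascending Loewy series for the nilpotent centroid elements. Starting at the center
  makes all terms stable under the whole centroid, whose commutators take values in the
  center.\<close>

primrec socle :: "nat \<Rightarrow> 'g::lie_algebra set"
  where "socle 0 = lie_center"
  | "socle (Suc k) = {x. \<forall>T \<in> nil_centroid. app T x \<in> socle k}"

lemma csubspace_socle: "csubspace (socle k)"
proof (induction k)
  case (Suc k)
  then show ?case
    by (intro csubspaceI) (simp_all add: complex_vector.subspace_0 complex_vector.subspace_add
        complex_vector.subspace_scale)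
qed (simp add: csubspace_center)

lemma socle_Suc: "socle k \<subseteq> socle (Suc k)"
  by (induction k) (auto intro: centroid_center nil_centroid_centroid)

lemma socle_mono: "k \<le> l \<Longrightarrow> socle k \<subseteq> socle l"
  by (rule lift_Suc_mono_le[of socle]) (rule socle_Suc)

text \<open>Write N T x = [N,T] x + T N x; the first summand is central and the second is covered by
  induction.\<close>

lemma centroid_socle:
  assumes "T \<in> centroid" "x \<in> socle k"
  shows "app T x \<in> socle k"
  using assms(2)
proof (induction k arbitrary: x)
  case (Suc k)
  have "app N (app T x) \<in> socle k" if N: "N \<in> nil_centroid" for N
  proof -
    have "lie N T \<in> central_homs"
      using lie_centroid_central nil_centroid_centroid[OF N] assms(1) .
    then have "app (lie N T) x \<in> socle k"
      using socle_mono[of 0 k] central_homs_into_center by fastforce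
    moreover have "app T (app N x) \<in> socle k"
      using Suc N by simp
    ultimately show ?thesis
      using complex_vector.subspace_add[OF csubspace_socle, of "app (lie N T) x" k "app T (app N x)"]
      by simp
  qed
  then show ?case by simp
qed (simp add: centroid_center assms(1))

text \<open>Write N D x = D N x - [D,N] x, where [D,N] is again a nilpotent centroid element and so
  lowers x by one step.\<close>

lemma derivation_socle:
  fixes D :: "'g::lie_algebra endo"
  assumes "finite_dim TYPE('g)" "(lie_center :: 'g set) \<subseteq> lie_product UNIV UNIV"
    and D: "D \<in> lie_derivations" and "x \<in> socle k"
  shows "app D x \<in> socle k"
  using assms(4)
proof (induction k arbitrary: x)
  case (Suc k)
  have "app N (app D x) \<in> socle k" if N: "N \<in> nil_centroid" for N
  proof -
    have "app (lie D N) x \<in> socle k"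
      using Suc.prems lie_derivation_nil_centroid[OF assms(1,2) D nil_centroid_centroid[OF N]]
      by auto
    moreover have "app D (app N x) \<in> socle k"
      using Suc N by simp
    ultimately show ?thesis
      using complex_vector.subspace_diff[OF csubspace_socle, of "app D (app N x)" k "app (lie D N) x"]
      by simp
  qed
  then show ?case by simp
qed (simp add: derivation_center D)

text \<open>If the socle series stopped at \<open>Z \<noteq> UNIV\<close>, then on a minimal centroid-invariant \<open>U\<close> above \<open>Z\<close> a
  nilpotent \<open>T\<close> would satisfy \<open>T U + Z \<in> {Z, U}\<close>, and \<open>T U + Z = U\<close> contradicts nilpotency, so \<open>U\<close>
  would belong to the next term.\<close>

lemma socle_exhausts:
  assumes fd: "finite_dim TYPE('g::lie_algebra)"
  obtains m where "socle m = (UNIV :: 'g set)"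
proof -
  \<comment> \<open>A term of greatest dimension, at which the increasing series must stop.\<close>
  obtain U0 :: "'g set" where "U0 \<in> range socle" and max: "\<And>W. W \<in> range socle \<Longrightarrow> U0 \<subseteq> W \<Longrightarrow> W = U0"
    by (rule finite_dim_maximal_subspace[OF fd, of "\<lambda>U. U \<in> range socle" "socle 0"])
      (use csubspace_socle in \<open>auto simp del: socle.simps\<close>)
  then obtain m where m: "U0 = socle m" by auto
  define Z where "Z = (socle m :: 'g set)"
  have Suc: "socle (Suc m) = Z"
    unfolding Z_def using max[of "socle (Suc m)"] socle_Suc[of m] m by (simp del: socle.simps)
  define Q where "Q U \<longleftrightarrow> csubspace U \<and> Z \<subset> U \<and> (\<forall>T \<in> centroid. \<forall>x \<in> U. app T x \<in> U)" for U :: "'g set"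
  have "Z = UNIV"
  proof (rule ccontr)
    assume "Z \<noteq> UNIV"
    then have "Q UNIV"
      by (auto simp: Q_def)
    then obtain U where U: "Q U" and min: "\<And>W. Q W \<Longrightarrow> W \<subseteq> U \<Longrightarrow> W = U"
      by (rule finite_dim_minimal_subspace[OF fd]) (auto simp: Q_def)
    have subU: "csubspace U" and ZU: "Z \<subset> U" and CU: "\<And>T x. T \<in> centroid \<Longrightarrow> x \<in> U \<Longrightarrow> app T x \<in> U"
      using U by (auto simp: Q_def)
    have subZ: "csubspace Z"
      unfolding Z_def by (rule csubspace_socle)
    have "app T ` U \<subseteq> Z" if T: "T \<in> nil_centroid" for T
    proof (rule ccontr)
      assume nZ: "\<not> app T ` U \<subseteq> Z"
      have T': "T \<in> centroid" using T by (rule nil_centroid_centroid)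
      define W where "W = app T ` U + Z"
      have subT: "csubspace (app T ` U)"
        by (rule csubspace_image[OF clinear_app subU])
      \<comment> \<open>For invariance, F T u differs from T F u by a value of [F,T], which is
        central and hence in \<open>Z\<close>.\<close>
      have "Q W"
        unfolding Q_def
      proof (intro conjI ballI)
        show "csubspace W"
          unfolding W_def by (rule csubspace_plus[OF subT subZ])
        show "Z \<subset> W"
          using subset_set_plus[OF subT subZ] nZ by (auto simp: W_def)
        fix F :: "'g endo" and x assume F: "F \<in> centroid" and "x \<in> W"
        then obtain u z where x: "x = app T u + z" "u \<in> U" "z \<in> Z"
          by (auto simp: W_def elim!: set_plus_elim)
        have "app (lie F T) u \<in> Z"
          using lie_centroid_central[OF F T'] socle_mono[of 0 m] central_homs_into_center
          by (fastforce simp: Z_def)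
        moreover have "app F z \<in> Z"
          using x(3) centroid_socle[OF F] by (simp add: Z_def)
        ultimately have "app (lie F T) u + app F z \<in> Z"
          by (rule complex_vector.subspace_add[OF subZ])
        moreover have "app F x = app T (app F u) + (app (lie F T) u + app F z)"
          by (simp add: x)
        ultimately show "app F x \<in> W"
          using CU[OF F x(2)] unfolding W_def by (metis imageI set_plus_intro)
      qed
      moreover have "W \<subseteq> U"
        using CU[OF T'] ZU complex_vector.subspace_add[OF subU] by (auto simp: W_def elim!: set_plus_elim)
      ultimately have WU: "W = U" by (rule min)
      \<comment> \<open>Iterating U = T U + Z expresses every element of \<open>U\<close> through
        T^n and \<open>Z\<close>; at an exponent where T^n = 0 only \<open>Z\<close>
        remains.\<close>
      have "\<exists>u\<in>U. \<exists>z\<in>Z. x = (app T ^^ n) u + z" if "x \<in> U" for n x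
      proof (induction n)
        case 0
        then show ?case
          using that complex_vector.subspace_0[OF subZ] by force
      next
        case (Suc n)
        then obtain u z where uz: "u \<in> U" "z \<in> Z" "x = (app T ^^ n) u + z" by blast
        have "u \<in> app T ` U + Z"
          using uz(1) WU by (simp add: W_def)
        then obtain u' z' where u': "u = app T u' + z'" "u' \<in> U" "z' \<in> Z"
          by (auto elim!: set_plus_elim)
        have add: "(app T ^^ n) (a + b) = (app T ^^ n) a + (app T ^^ n) b" for a b
          by (induction n) simp_all
        have "(app T ^^ n) z' \<in> Z"
          using u'(3) by (induction n) (auto simp: Z_def intro: centroid_socle[OF T'])
        then have "(app T ^^ n) z' + z \<in> Z"
          using uz(2) by (rule complex_vector.subspace_add[OF subZ])
        moreover have "x = (app T ^^ Suc n) u' + ((app T ^^ n) z' + z)"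
          by (simp add: uz(3) u'(1) add funpow_swap1)
        ultimately show ?case using u'(2) by blast
      qed
      moreover obtain n where "\<forall>x. (app T ^^ n) x = 0"
        using T by (auto simp: nil_centroid_def)
      ultimately have "U \<subseteq> Z"
        by (metis add_0 subsetI)
      then show False using ZU by blast
    qed
    then have "U \<subseteq> socle (Suc m)"
      by (auto simp: Z_def)
    then show False
      using Suc ZU by auto
  qed
  then show ?thesis
    using that Z_def by simp
qed

text \<open>Nothing is required on \<open>socle 0\<close>: a derivation followed by a nilpotent
  centroid element should qualify, and it need not kill the center.\<close>

definition lowering :: "'g::lie_algebra endo set"
  where "lowering = {F \<in> lie_derivations. \<forall>k. \<forall>x \<in> socle (Suc k). app F x \<in> socle k}"

lemma lowering_derivation: "F \<in> lowering \<Longrightarrow> F \<in> lie_derivations"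
  by (simp add: lowering_def)

lemma lie_ideal_lowering:
  assumes "finite_dim TYPE('g::lie_algebra)" "(lie_center :: 'g set) \<subseteq> lie_product UNIV UNIV"
  shows "lie_ideal lowering (lie_derivations :: 'g endo set)"
  unfolding lie_ideal_def
proof (intro conjI ballI)
  show "csubspace (lowering :: 'g endo set)"
    by (rule csubspaceI) (auto simp del: socle.simps simp: lowering_def intro!: csubspace_socle
        csubspace_derivations complex_vector.subspace_0 complex_vector.subspace_add
        complex_vector.subspace_scale)
  show "(lowering :: 'g endo set) \<subseteq> lie_derivations"
    by (auto simp: lowering_def)
  fix D F :: "'g endo" assume D: "D \<in> lie_derivations" and F: "F \<in> lowering"
  have "app (lie D F) x \<in> socle k" if x: "x \<in> socle (Suc k)" for x k
  proof -
    have "app D (app F x) \<in> socle k" "app F (app D x) \<in> socle k"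
      using x F derivation_socle[OF assms D] by (auto simp del: socle.simps simp: lowering_def)
    then show ?thesis
      using complex_vector.subspace_diff[OF csubspace_socle] by auto
  qed
  moreover have "lie D F \<in> lie_derivations"
    using D F lie_subalgebra_derivations by (auto simp: lowering_def lie_subalgebra_def)
  ultimately show "lie D F \<in> lowering"
    by (auto simp del: socle.simps simp: lowering_def)
qed

text \<open>\<open>D\<close> preserves \<open>socle (Suc k)\<close> and \<open>T\<close> takes it to
  \<open>socle k\<close>. Most lowering derivations below arise by such a factorization.\<close>

lemma nil_centroid_comp_derivation:
  fixes D :: "'g::lie_algebra endo"
  assumes "finite_dim TYPE('g)" "(lie_center :: 'g set) \<subseteq> lie_product UNIV UNIV"
    and D: "D \<in> lie_derivations" and T: "T \<in> nil_centroid"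
  shows "T \<odot> D \<in> lowering"
proof -
  have "app T (app D x) \<in> socle k" if "x \<in> socle (Suc k)" for x k
    using derivation_socle[OF assms(1,2) D that] T by simp
  then show ?thesis
    using centroid_comp_derivation[OF nil_centroid_centroid[OF T] D] by (simp add: lowering_def)
qed

lemma into_center_lowering:
  assumes "F \<in> lie_derivations" "\<And>x. app F x \<in> lie_center"
  shows "F \<in> lowering"
  using assms socle_mono[of 0] by (auto simp del: socle.simps(2) simp: lowering_def)

text \<open>Elements deep in the derived series take all their values in the center. Such
  derivations kill every bracket, hence also the center, so the composite of any two of them is
  zero.\<close>

lemma lowering_solvable:
  assumes fd: "finite_dim TYPE('g::lie_algebra)"
    and center: "(lie_center :: 'g set) \<subseteq> lie_product UNIV UNIV"
  obtains n where "derived_series n (lowering :: 'g endo set) \<subseteq> {0}"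
proof -
  let ?N = "lowering :: 'g endo set"
  have subN: "lie_subalgebra ?N"
    by (rule lie_subalgebra_ideal[OF lie_ideal_lowering[OF assms]])
  \<comment> \<open>A gain of one step per derived term suffices, since some \<open>socle m\<close>
    is the whole space.\<close>
  have drop: "derived_series n ?N \<subseteq> {F. \<forall>k. \<forall>x \<in> socle (k + Suc n). app F x \<in> socle k}" for n
  proof (induction n)
    case 0
    then show ?case by (auto simp del: socle.simps simp: lowering_def)
  next
    case (Suc n)
    let ?V = "{F :: 'g endo. \<forall>k. \<forall>x \<in> socle (k + Suc (Suc n)). app F x \<in> socle k}"
    have "lie_product (derived_series n ?N) (derived_series n ?N) \<subseteq> ?V"
    proof (rule lie_product_minimal)
      show "csubspace ?V"
        by (rule csubspaceI) (auto simp del: socle.simps intro!: csubspace_socle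
            complex_vector.subspace_0 complex_vector.subspace_add complex_vector.subspace_scale)
      fix F G assume FG: "F \<in> derived_series n ?N" "G \<in> derived_series n ?N"
      have comp: "app F (app G x) \<in> socle k" if "F \<in> derived_series n ?N" "G \<in> derived_series n ?N"
        "x \<in> socle (k + Suc (Suc n))" for F G x k
      proof -
        have "app G x \<in> socle (Suc k)"
          using Suc that(2,3) by (auto simp del: socle.simps)
        then have "app G x \<in> socle (k + Suc n)"
          using socle_mono[of "Suc k" "k + Suc n"] by (auto simp del: socle.simps)
        then show ?thesis
          using Suc that(1) by (auto simp del: socle.simps)
      qed
      show "lie F G \<in> ?V"
        using comp[OF FG] comp[OF FG(2,1)]
        by (auto simp del: socle.simps intro!: complex_vector.subspace_diff csubspace_socle)
    qed
    then show ?case by simp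
  qed
  obtain m where m: "socle m = (UNIV :: 'g set)"
    using socle_exhausts[OF fd] .
  have into: "F \<in> lie_derivations" "app F x \<in> lie_center" if "F \<in> derived_series m ?N" for F x
  proof -
    have "x \<in> socle (0 + Suc m)"
      using m socle_Suc[of m] by (auto simp del: socle.simps)
    then show "app F x \<in> lie_center"
      using that drop[of m] socle.simps(1) by blast
    show "F \<in> lie_derivations"
      using that derived_series_subset[OF subN] lowering_derivation by blast
  qed
  have kill: "app F x = 0" if F: "F \<in> derived_series m ?N" and x: "x \<in> lie_product UNIV UNIV" for F x
  proof -
    have "lie_product UNIV UNIV \<subseteq> {x. app F x \<in> {0}}"
    proof (rule lie_product_minimal)
      show "csubspace {x. app F x \<in> {0}}"
        by (rule csubspace_vimage) simp_all
      show "lie x y \<in> {x. app F x \<in> {0}}" for x y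
        using into[OF F] lie_anticomm[of y "app F x"] by (simp add: derivation_lie lie_center_def)
    qed
    then show ?thesis using x by auto
  qed
  have "derived_series (Suc m) ?N \<subseteq> {0}"
    unfolding derived_series.simps
  proof (rule lie_product_minimal)
    fix F G assume FG: "F \<in> derived_series m ?N" "G \<in> derived_series m ?N"
    \<comment> \<open>A value of \<open>G\<close> is central and so lies in the derived algebra,
      where \<open>F\<close> vanishes; the same holds with \<open>F\<close> and \<open>G\<close>
      exchanged.\<close>
    have "lie F G = 0"
      using kill[OF FG(1)] kill[OF FG(2)] into(2)[OF FG(1)] into(2)[OF FG(2)] center
      by (intro endo_eqI) (simp add: subset_iff)
    then show "lie F G \<in> {0}" by simp
  qed simp
  then show ?thesis by (rule that)
qed

section \<open>Finite dimensional commutative algebras\<close>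

lemma funpow_mult_endo: "(app (mult_endo a) ^^ n) b = a ^ n * b"
  by (induction n) (simp_all add: mult.assoc)

lemma clinear_mult_endo: "clinear mult_endo"
  by (rule clinearI; rule endo_eqI) (simp_all add: distrib_right scaleC_mult_left)

lemma mult_endo_comp: "mult_endo a \<odot> mult_endo b = mult_endo (a * b)"
  by (rule endo_eqI) (simp add: mult.assoc)

lemma mult_endo_1: "mult_endo 1 = endo_id"
  by (rule endo_eqI) simp

lemma csubspace_algebra_derivations: "csubspace (algebra_derivations :: 'a::complex_comm_algebra endo set)"
  by (rule csubspaceI) (auto simp: algebra_derivations_def algebra_simps scaleC_add_right
      scaleC_mult_left scaleC_mult_right)

lemma lie_derivation_mult_endo:
  "d \<in> algebra_derivations \<Longrightarrow> lie d (mult_endo a) = mult_endo (app d a)"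
  by (rule endo_eqI) (simp add: algebra_derivations_def)

lemma algebra_derivation_comp_mult:
  "d \<in> algebra_derivations \<Longrightarrow> mult_endo a \<odot> d \<in> algebra_derivations"
  by (simp add: algebra_derivations_def distrib_left ac_simps)

lemma lie_subalgebra_algebra_derivations:
  "lie_subalgebra (algebra_derivations :: 'a::complex_comm_algebra endo set)"
  unfolding lie_subalgebra_def
proof (intro conjI ballI csubspace_algebra_derivations)
  fix d e :: "'a endo" assume "d \<in> algebra_derivations" "e \<in> algebra_derivations"
  then show "lie d e \<in> algebra_derivations"
    by (simp add: algebra_derivations_def algebra_simps)
qed

text \<open>The commutator of \<open>d\<close> with the multiplication by \<open>a\<close> is the
  multiplication by d(a), and multiplications commute. So \<open>commutator_nilpotent_on\<close>
  applies on the whole algebra; evaluating at 1 gives the power of d(a).\<close>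

lemma derivation_nilpotent:
  fixes d :: "'a::complex_comm_algebra endo"
  assumes fd: "finite_dim TYPE('a)" and d: "d \<in> algebra_derivations"
  obtains n where "app d a ^ n = 0"
proof -
  obtain m where m: "\<And>x. x \<in> UNIV \<Longrightarrow> (app (lie d (mult_endo a)) ^^ m) x = 0"
    by (rule commutator_nilpotent_on[OF fd complex_vector.subspace_UNIV, of d "range mult_endo" "mult_endo a"])
      (auto simp: lie_derivation_mult_endo[OF d] ac_simps)
  have "app d a ^ m = 0"
    using m[of 1] by (simp add: lie_derivation_mult_endo[OF d] funpow_mult_endo)
  then show ?thesis by (rule that)
qed

section \<open>Maximal ideals, the Jacobson radical and characters\<close>

lemma ring_ideal_scale:
  assumes "ring_ideal_of I UNIV" "x \<in> I"
  shows "c *\<^sub>C x \<in> I"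
proof -
  have "c *\<^sub>C x = (c *\<^sub>C 1) * x"
    by (simp add: scaleC_mult_left)
  then show ?thesis
    using assms by (simp add: ring_ideal_of_def)
qed

lemma csubspace_ring_ideal: "ring_ideal_of I UNIV \<Longrightarrow> csubspace I"
  by (rule csubspaceI) (auto simp: ring_ideal_scale, auto simp: ring_ideal_of_def)

lemma proper_ideal_in_maximal:
  fixes I :: "'a::complex_comm_algebra set"
  assumes fd: "finite_dim TYPE('a)" and I: "ring_ideal_of I UNIV" "I \<noteq> UNIV"
  obtains M where "maximal_ideal_of M UNIV" "I \<subseteq> M"
proof -
  obtain M where "ring_ideal_of M UNIV \<and> M \<noteq> UNIV \<and> I \<subseteq> M"
    and "\<And>W. ring_ideal_of W UNIV \<and> W \<noteq> UNIV \<and> I \<subseteq> W \<Longrightarrow> M \<subseteq> W \<Longrightarrow> W = M"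
    by (rule finite_dim_maximal_subspace[OF fd, of "\<lambda>M. ring_ideal_of M UNIV \<and> M \<noteq> UNIV \<and> I \<subseteq> M" I])
      (use I csubspace_ring_ideal in auto)
  then show ?thesis
    using that[of M] unfolding maximal_ideal_of_def by (metis order_trans)
qed

lemma maximal_ideal_one:
  assumes M: "maximal_ideal_of M UNIV"
  shows "1 \<notin> M"
proof
  assume "1 \<in> M"
  moreover have "\<forall>s. \<forall>a\<in>M. s * a \<in> M"
    using M by (simp add: maximal_ideal_of_def ring_ideal_of_def)
  ultimately have "s * 1 \<in> M" for s
    by blast
  then have "M = UNIV" by auto
  then show False
    using M by (simp add: maximal_ideal_of_def)
qed

text \<open>If x is outside \<open>M\<close>, then M + A x is everything; multiply 1 = m + r x by
  y.\<close>

lemma maximal_ideal_prime: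
  fixes M :: "'a::complex_comm_algebra set"
  assumes M: "maximal_ideal_of M UNIV" and xy: "x * y \<in> M" and x: "x \<notin> M"
  shows "y \<in> M"
proof -
  have ideal: "ring_ideal_of M UNIV"
    using M by (simp add: maximal_ideal_of_def)
  note sub = csubspace_ring_ideal[OF ideal]
  define I where "I = M + range (\<lambda>r. r * x)"
  have "csubspace (range (\<lambda>r. r * x))"
    by (rule csubspace_image) (auto intro: clinearI simp: distrib_right scaleC_mult_left)
  note I = csubspace_plus[OF sub this, folded I_def] subset_set_plus[OF sub this, folded I_def]
  have "ring_ideal_of I UNIV"
    unfolding ring_ideal_of_def
  proof (intro conjI ballI)
    fix s i assume "i \<in> I"
    then obtain m r where i: "i = m + r * x" "m \<in> M"
      by (auto simp: I_def elim!: set_plus_elim)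
    have "s * i = s * m + (s * r) * x" "s * m \<in> M"
      using i ideal by (simp_all add: distrib_left mult.assoc ring_ideal_of_def)
    then show "s * i \<in> I"
      unfolding I_def using set_plus_intro[of "s * m" M "(s * r) * x"] by simp
  qed (simp_all add: complex_vector.subspace_0[OF I(1)] complex_vector.subspace_add[OF I(1)])
  moreover have "1 * x \<in> I"
    using I(3) by blast
  ultimately have "I = UNIV"
    using M x I(2) unfolding maximal_ideal_of_def by (metis mult_1)
  then have "1 \<in> M + range (\<lambda>r. r * x)"
    by (simp add: I_def)
  then obtain m r where m: "1 = m + r * x" "m \<in> M"
    by (auto elim!: set_plus_elim)
  have "y = y * (m + r * x)"
    unfolding m(1)[symmetric] by simp
  also have "\<dots> = y * m + r * (x * y)"
    by (simp add: distrib_left ac_simps)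
  finally have y: "y = y * m + r * (x * y)" .
  have "y * m \<in> M" "r * (x * y) \<in> M"
    using ideal m(2) xy by (auto simp: ring_ideal_of_def)
  then have "y * m + r * (x * y) \<in> M"
    by (rule complex_vector.subspace_add[OF sub])
  then show ?thesis
    by (simp only: y[symmetric])
qed

lemma nilpotent_in_jacobson_radical:
  fixes a :: "'a::complex_comm_algebra"
  assumes "a ^ n = 0"
  shows "a \<in> jacobson_radical UNIV"
proof -
  have "a \<in> M" if M: "maximal_ideal_of M UNIV" for M
  proof -
    have "a ^ k \<in> M \<Longrightarrow> a \<in> M" for k
    proof (induction k)
      case 0
      then show ?case using maximal_ideal_one[OF M] by simp
    next
      case (Suc k)
      then show ?case using maximal_ideal_prime[OF M, of a "a ^ k"] by auto
    qed
    moreover have "a ^ n \<in> M"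
      using assms M by (simp add: maximal_ideal_of_def ring_ideal_of_def)
    ultimately show ?thesis .
  qed
  then show ?thesis by (simp add: jacobson_radical_def)
qed

text \<open>The chain of the ideals a^n A becomes stationary, which gives a^n = a^(n+1) c, that is,
  a^n u = 0 with u = 1 - a c. This u is a unit: a maximal ideal containing it would contain a as
  well and hence 1.\<close>

lemma jacobson_radical_nilpotent:
  fixes a :: "'a::complex_comm_algebra"
  assumes fd: "finite_dim TYPE('a)" and a: "a \<in> jacobson_radical UNIV"
  obtains n where "a ^ n = 0"
proof -
  have lin: "clinear (\<lambda>c. b * c)" for b :: 'a
    by (rule clinearI) (simp_all add: distrib_left scaleC_mult_right)
  define U where "U n = range (\<lambda>c. a ^ n * c)" for n
  obtain V where "V \<in> range U" and min: "\<And>W. W \<in> range U \<Longrightarrow> W \<subseteq> V \<Longrightarrow> W = V"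
  proof (rule finite_dim_minimal_subspace[OF fd, of "\<lambda>V. V \<in> range U" "U 0"])
    show "csubspace V" if "V \<in> range U" for V
      using that csubspace_image[OF lin complex_vector.subspace_UNIV] by (auto simp: U_def)
  qed auto
  then obtain n where V: "V = U n" by auto
  have "U (Suc n) \<subseteq> U n"
    by (auto simp: U_def mult.assoc mult.left_commute[of a])
  then have "a ^ n \<in> U (Suc n)"
    using min[of "U (Suc n)"] by (simp add: V) (auto simp: U_def intro: image_eqI[of _ _ 1])
  then obtain c where c: "a ^ n = a ^ Suc n * c" by (auto simp: U_def)
  define u where "u = 1 - a * c"
  have u0: "a ^ n * u = 0"
    using c by (simp add: u_def right_diff_distrib ac_simps)
  have "1 \<in> range (\<lambda>r. u * r)"
  proof (rule ccontr)
    assume "1 \<notin> range (\<lambda>r. u * r)"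
    moreover have "ring_ideal_of (range (\<lambda>r. u * r)) UNIV"
      unfolding ring_ideal_of_def
      by (auto simp: mult.left_commute[of _ u] simp flip: distrib_left intro: image_eqI[of _ _ 0])
    ultimately obtain M where M: "maximal_ideal_of M UNIV" "range (\<lambda>r. u * r) \<subseteq> M"
      using proper_ideal_in_maximal[OF fd] by (metis UNIV_I)
    have ideal: "ring_ideal_of M UNIV"
      using M by (simp add: maximal_ideal_of_def)
    have "u \<in> M" using M(2) by (metis mult.right_neutral rangeI subsetD)
    moreover have "a \<in> M" using a M(1) by (auto simp: jacobson_radical_def)
    then have "c * a \<in> M" using ideal by (simp add: ring_ideal_of_def)
    ultimately have "u + c * a \<in> M" using ideal by (simp add: ring_ideal_of_def)
    then show False
      using maximal_ideal_one[OF M(1)] by (simp add: u_def mult.commute)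
  qed
  then obtain r where "1 = u * r" by auto
  then have "a ^ n = a ^ n * u * r"
    by (metis mult.assoc mult.right_neutral)
  then show ?thesis
    using that u0 by simp
qed

lemma jacobson_radical_ideal: "ring_ideal_of (jacobson_radical UNIV) UNIV"
  by (auto simp: jacobson_radical_def ring_ideal_of_def maximal_ideal_of_def)

definition algebra_character :: "('a::complex_comm_algebra \<Rightarrow> complex) \<Rightarrow> bool"
  where "algebra_character \<chi> \<longleftrightarrow> clinear \<chi> \<and> \<chi> 1 = 1 \<and> (\<forall>a b. \<chi> (a * b) = \<chi> a * \<chi> b)"

text \<open>This is A/M = \<complex> without forming the quotient: every a is congruent modulo
  \<open>M\<close> to a scalar, because \<open>M\<close> is prime and a polynomial annihilating a
  splits into linear factors. The scalar is unique as 1 is not in \<open>M\<close>, and uniqueness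
  makes it additive and multiplicative in a.\<close>

lemma maximal_ideal_character:
  fixes M :: "'a::complex_comm_algebra set"
  assumes fd: "finite_dim TYPE('a)" and M: "maximal_ideal_of M UNIV"
  obtains \<chi> where "algebra_character \<chi>" "\<And>a. \<chi> a = 0 \<longleftrightarrow> a \<in> M"
proof -
  have ideal: "ring_ideal_of M UNIV"
    using M by (simp add: maximal_ideal_of_def)
  note sub = csubspace_ring_ideal[OF ideal]
  have mult: "b * x \<in> M" "x * b \<in> M" if "x \<in> M" for b x
    using ideal that by (simp_all add: ring_ideal_of_def mult.commute[of x])
  have scalar: "c = 0" if "c *\<^sub>C (1 :: 'a) \<in> M" for c
  proof (rule ccontr)
    assume "c \<noteq> 0"
    then show False
      using complex_vector.subspace_scale[OF sub that, of "inverse c"] maximal_ideal_one[OF M]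
      by (simp add: scaleC_scaleC scaleC_one)
  qed
  have ex: "\<exists>c. a - c *\<^sub>C 1 \<in> M" for a
  proof -
    \<comment> \<open>Applying p(\<open>mult_endo a\<close>) to 1 gives p(a). Induction on the
      degree splits off one root z at a time, and primality puts either a - z or the smaller
      polynomial value into \<open>M\<close>.\<close>
    have "\<exists>c. a - c *\<^sub>C 1 \<in> M" if "p \<noteq> 0" "app (peval (mult_endo a) p) 1 \<in> M" for p
      using that
    proof (induction "degree p" arbitrary: p rule: less_induct)
      case less
      show ?case
      proof (cases "degree p = 0")
        case True
        then obtain c where "p = [:c:]" by (metis degree_eq_zeroE)
        then show ?thesis using less.prems scalar[of c] by simp
      next
        case False
        then obtain z where "poly p z = 0"
          using fundamental_theorem_of_algebra[of p] by (auto simp: constant_degree)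
        then obtain q where q: "p = [:- z, 1:] * q"
          by (auto simp: poly_eq_0_iff_dvd)
        then have nz: "q \<noteq> 0"
          using less.prems(1) by auto
        then have "degree p = Suc (degree q)"
          unfolding q by (subst degree_mult_eq) auto
        have "p = pCons 0 q + smult (- z) q"
          using q by simp
        then have "app (peval (mult_endo a) p) 1 = (a - z *\<^sub>C 1) * app (peval (mult_endo a) q) 1"
          by (simp only: peval_add peval_smult) (simp add: left_diff_distrib scaleC_mult_left)
        then show ?thesis
          using less.prems(2) maximal_ideal_prime[OF M] less.hyps[of q] nz \<open>degree p = _\<close> by auto
      qed
    qed
    moreover obtain p where "p \<noteq> 0" "peval (mult_endo a) p = 0"
      using annihilating_poly[OF fd, of "mult_endo a"] .
    ultimately show ?thesis
      using complex_vector.subspace_0[OF sub] by (metis app_simps(1))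
  qed
  then obtain \<chi> where \<chi>: "\<And>a. a - \<chi> a *\<^sub>C 1 \<in> M" by metis
  have uniq: "\<chi> a = c" if "a - c *\<^sub>C 1 \<in> M" for a c
  proof -
    have "(\<chi> a - c) *\<^sub>C 1 = (a - c *\<^sub>C 1) - (a - \<chi> a *\<^sub>C 1)"
      by (simp add: complex_vector.scale_left_diff_distrib)
    then have "\<chi> a - c = 0"
      using complex_vector.subspace_diff[OF sub that \<chi>[of a]] by (intro scalar) simp
    then show ?thesis by simp
  qed
  have "algebra_character \<chi>"
    unfolding algebra_character_def
  proof (intro conjI clinearI allI)
    show "\<chi> (a + b) = \<chi> a + \<chi> b" for a b
      using complex_vector.subspace_add[OF sub \<chi>[of a] \<chi>[of b]]
      by (intro uniq) (simp add: scaleC_add_left algebra_simps)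
    show "\<chi> (c *\<^sub>C a) = c *\<^sub>C \<chi> a" for c a
      using complex_vector.subspace_scale[OF sub \<chi>[of a], of c]
      by (intro uniq) (simp add: complex_vector.scale_right_diff_distrib scaleC_scaleC scaleC_complex_def)
    show "\<chi> 1 = 1"
      by (intro uniq) (simp add: scaleC_one complex_vector.subspace_0[OF sub])
    show "\<chi> (a * b) = \<chi> a * \<chi> b" for a b
    proof (rule uniq)
      have "a * (b - \<chi> b *\<^sub>C 1) + \<chi> b *\<^sub>C (a - \<chi> a *\<^sub>C 1) \<in> M"
        by (intro complex_vector.subspace_add[OF sub] complex_vector.subspace_scale[OF sub] \<chi> mult)
      then show "a * b - (\<chi> a * \<chi> b) *\<^sub>C 1 \<in> M"
        by (simp add: right_diff_distrib complex_vector.scale_right_diff_distrib scaleC_scaleC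
            scaleC_mult_right mult.commute)
    qed
  qed
  moreover have "\<chi> a = 0 \<longleftrightarrow> a \<in> M" for a
    using \<chi>[of a] uniq[of a 0] by auto
  ultimately show ?thesis by (rule that)
qed

lemma characters_separate:
  fixes a :: "'a::complex_comm_algebra"
  assumes fd: "finite_dim TYPE('a)" and a: "\<And>\<chi>. algebra_character \<chi> \<Longrightarrow> \<chi> a = 0"
  shows "a \<in> jacobson_radical UNIV"
proof -
  have "a \<in> M" if "maximal_ideal_of M UNIV" for M
    by (rule maximal_ideal_character[OF fd that]) (use a in blast)
  then show ?thesis
    by (simp add: jacobson_radical_def)
qed

section \<open>Tensor products and derivations of current algebras\<close>

text \<open>Scalars are moved from the first factor to the second: h (\<Sum> c_b b) w = \<Sum> h b
  (c_b w). For an independent \<open>B\<close>, questions about a tensor become questions about its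
  coefficients in \<open>W\<close>.\<close>

lemma cspan_bilinear_expansion:
  assumes h: "cbilinear h" and W: "csubspace W" and U: "U \<subseteq> cspan B"
    and t: "t \<in> cspan {h u w | u w. u \<in> U \<and> w \<in> W}"
  obtains C w where "finite C" "C \<subseteq> B" "\<And>b. w b \<in> W" "t = (\<Sum>b\<in>C. h b (w b))"
proof -
  have l: "clinear (h x)" and r: "clinear (\<lambda>x. h x y)" for x y
    using h by (auto simp: cbilinear_def)
  define X where "X = {t. \<exists>C w. finite C \<and> C \<subseteq> B \<and> (\<forall>b. w b \<in> W) \<and> t = (\<Sum>b\<in>C. h b (w b))}"
  have XI: "(\<Sum>b\<in>C. h b (w b)) \<in> X" if "finite C" "C \<subseteq> B" "\<And>b. w b \<in> W" for C w
    unfolding X_def using that by (intro CollectI exI[of _ C] exI[of _ w]) simp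
  have XE: thesis if "x \<in> X"
    "\<And>C w. finite C \<Longrightarrow> C \<subseteq> B \<Longrightarrow> \<forall>b. w b \<in> W \<Longrightarrow> x = (\<Sum>b\<in>C. h b (w b)) \<Longrightarrow> thesis" for x thesis
    using that(1) unfolding X_def by (elim CollectE exE conjE) (rule that(2))
  have "csubspace X"
  proof (rule csubspaceI)
    show "0 \<in> X"
      using XI[of "{}" "\<lambda>_. 0"] complex_vector.subspace_0[OF W] by simp
    show "c *\<^sub>C x \<in> X" if "x \<in> X" for c x
    proof -
      obtain C w where x: "finite C" "C \<subseteq> B" "\<forall>b. w b \<in> W" "x = (\<Sum>b\<in>C. h b (w b))"
        by (rule XE[OF \<open>x \<in> X\<close>])
      have "c *\<^sub>C x = (\<Sum>b\<in>C. h b (c *\<^sub>C w b))"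
        by (simp add: x(4) complex_vector.scale_sum_right clinear_scale[OF l])
      then show ?thesis
        using XI[of C "\<lambda>b. c *\<^sub>C w b"] x(1-3) complex_vector.subspace_scale[OF W] by simp
    qed
    show "x + y \<in> X" if "x \<in> X" "y \<in> X" for x y
    proof -
      obtain C w where x: "finite C" "C \<subseteq> B" "\<forall>b. w b \<in> W" "x = (\<Sum>b\<in>C. h b (w b))"
        by (rule XE[OF \<open>x \<in> X\<close>])
      obtain C' w' where y: "finite C'" "C' \<subseteq> B" "\<forall>b. w' b \<in> W" "y = (\<Sum>b\<in>C'. h b (w' b))"
        by (rule XE[OF \<open>y \<in> X\<close>])
      \<comment> \<open>Both sums are extended by zero coefficients to the union of their index sets
        before being added.\<close>
      define v where "v b = (if b \<in> C then w b else 0) + (if b \<in> C' then w' b else 0)" for b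
      have "x + y = (\<Sum>b\<in>C \<union> C'. h b (if b \<in> C then w b else 0))
          + (\<Sum>b\<in>C \<union> C'. h b (if b \<in> C' then w' b else 0))"
        unfolding x(4) y(4) by (intro arg_cong2[of _ _ _ _ "(+)"] sum.mono_neutral_cong_left)
          (auto simp: x(1) y(1) clinear_zero[OF l])
      also have "\<dots> = (\<Sum>b\<in>C \<union> C'. h b (v b))"
        by (simp add: v_def clinear_add[OF l] sum.distrib)
      also have "\<dots> \<in> X"
        by (rule XI) (use x y complex_vector.subspace_0[OF W] complex_vector.subspace_add[OF W]
          in \<open>auto simp: v_def\<close>)
      finally show ?thesis .
    qed
  qed
  moreover have "h u w \<in> X" if "u \<in> U" "w \<in> W" for u w
  proof -
    have "u \<in> cspan B" using that(1) U by blast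
    then obtain C c where C: "finite C" "C \<subseteq> B" "u = (\<Sum>b\<in>C. c b *\<^sub>C b)"
      unfolding complex_vector.span_explicit by blast
    have "h u w = (\<Sum>b\<in>C. h b (c b *\<^sub>C w))"
      unfolding C(3) clinear_sum[OF r] by (simp add: clinear_scale[OF r] clinear_scale[OF l])
    then show ?thesis
      using XI[of C "\<lambda>b. c b *\<^sub>C w"] C complex_vector.subspace_scale[OF W that(2)] by simp
  qed
  ultimately have "cspan {h u w | u w. u \<in> U \<and> w \<in> W} \<subseteq> X"
    by (intro complex_vector.span_minimal) blast+
  then have "t \<in> X"
    using t by blast
  then show ?thesis
    by (rule XE) (rule that; simp)
qed

text \<open>This is id \<otimes> f, with values in V \<otimes> \<complex> identified with V.
  Coordinate functionals of a basis of the second factor yield the components of a tensor.\<close>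

definition contract :: "('w::complex_vector \<Rightarrow> complex) \<Rightarrow> ('v::complex_vector, 'w) tensor \<Rightarrow> 'v"
  where "contract f = tensor_lift (\<lambda>x b. f b *\<^sub>C x)"

lemma cbilinear_contract: "clinear f \<Longrightarrow> cbilinear (\<lambda>x b. f b *\<^sub>C x)"
  unfolding cbilinear_def by (intro conjI allI clinearI)
    (simp_all add: clinear_add clinear_scale scaleC_add_left scaleC_add_right scaleC_scaleC
      scaleC_complex_def mult.commute)

lemma contract_tens [simp]: "clinear f \<Longrightarrow> contract f (tens x b) = f b *\<^sub>C x"
  by (simp add: contract_def cbilinear_contract)

lemma clinear_contract: "clinear f \<Longrightarrow> clinear (contract f)"
  unfolding contract_def by (intro clinear_tensor_lift cbilinear_contract)

lemma clinear_tens: "clinear (tens x)" "clinear (\<lambda>x. tens x b)"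
  using cbilinear_tens unfolding cbilinear_def by auto

lemma clinear_sum_fun:
  assumes "\<And>i. i \<in> I \<Longrightarrow> clinear (f i)"
  shows "clinear (\<lambda>x. \<Sum>i\<in>I. f i x)"
  using assms by (intro clinearI)
    (simp_all add: clinear_add clinear_scale sum.distrib complex_vector.scale_sum_right)

lemma tensor_basis_expansion:
  fixes t :: "('v::complex_vector, 'w::complex_vector) tensor"
  assumes B: "finite B" "\<not> complex_vector.dependent B" "cspan B = (UNIV :: 'w set)"
  shows "(\<Sum>b\<in>B. tens (contract (\<lambda>v. complex_vector.representation B v b) t) b) = t"
proof (rule tensor_lift_unique[where g = "\<lambda>t. t"])
  note lin = clinear_representation[OF B(2,3)]
  show "clinear (\<lambda>t. \<Sum>b\<in>B. tens (contract (\<lambda>v. complex_vector.representation B v b) t) b)"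
    by (intro clinear_sum_fun clinear_compose[OF clinear_tens(2) clinear_contract[OF lin]])
  fix x :: 'v and a
  have "(\<Sum>b\<in>B. tens (contract (\<lambda>v. complex_vector.representation B v b) (tens x a)) b)
      = tens x (\<Sum>b\<in>B. complex_vector.representation B a b *\<^sub>C b)"
    by (simp add: contract_tens[OF lin] clinear_sum[OF clinear_tens(1)] tens_simps)
  then show "(\<Sum>b\<in>B. tens (contract (\<lambda>v. complex_vector.representation B v b) (tens x a)) b) = tens x a"
    by (simp only: sum_representation[OF B])
qed (rule clinearI; simp)

lemma finite_dim_tensor:
  assumes "finite_dim TYPE('v::complex_vector)" "finite_dim TYPE('w::complex_vector)"
  shows "finite_dim TYPE(('v, 'w) tensor)"
proof -
  obtain B :: "'v set" where B: "finite B" "\<not> complex_vector.dependent B" "cspan B = UNIV"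
    using finite_dim_basis[OF assms(1)] .
  obtain C :: "'w set" where C: "finite C" "\<not> complex_vector.dependent C" "cspan C = UNIV"
    using finite_dim_basis[OF assms(2)] .
  define E where "E = (\<lambda>(b, c). tens b c) ` (B \<times> C)"
  have "t \<in> cspan E" for t
  proof (induction t rule: tensor_induct)
    case (tens x a)
    show ?case
      by (rule cspan_bilinear_mem[OF cbilinear_tens, of _ x B a C])
        (use B C in \<open>auto simp: E_def intro!: complex_vector.span_base\<close>)
  qed (auto intro: complex_vector.span_add complex_vector.span_zero)
  then have "cspan E = UNIV" "finite E"
    using B(1) C(1) by (auto simp: E_def)
  then show ?thesis
    unfolding finite_dim_def by blast
qed

section \<open>Tensor products of maps and their action on the current algebra\<close>

lemma tensor_endo_eqI:
  assumes "\<And>x b. app F (tens x b) = app G (tens x b)"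
  shows "F = G"
  by (rule endo_eqI, rule tensor_lift_unique) (simp_all add: assms)

lemma cbilinear_tensor_endo: "cbilinear tensor_endo"
  unfolding cbilinear_def
  by (intro conjI allI clinearI tensor_endo_eqI) (simp_all add: tens_simps)

lemma clinear_tensor_endo: "clinear (tensor_endo T)" "clinear (\<lambda>T. tensor_endo T f)"
  using cbilinear_tensor_endo unfolding cbilinear_def by auto

lemma tensor_endo_comp: "tensor_endo T f \<odot> tensor_endo T' f' = tensor_endo (T \<odot> T') (f \<odot> f')"
  by (rule tensor_endo_eqI) simp

text \<open>Insert T' T \<otimes> f f' into the commutator. With this splitting the second summand
  disappears for multiplications, and the first is a central homomorphism tensored with a map when
  \<open>T\<close> and \<open>T'\<close> are in the centroid.\<close>

lemma lie_tensor_endo: "lie (tensor_endo T f) (tensor_endo T' f')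
    = tensor_endo (lie T T') (f \<odot> f') + tensor_endo (T' \<odot> T) (lie f f')"
  unfolding lie_conv_comp tensor_endo_comp
  by (simp add: clinear_diff[OF clinear_tensor_endo(1)] clinear_diff[OF clinear_tensor_endo(2)])

lemma tensor_endo_in_maps: "T \<in> U \<Longrightarrow> f \<in> W \<Longrightarrow> tensor_endo T f \<in> tensor_maps U W"
  unfolding tensor_maps_def by (rule complex_vector.span_base) blast

lemma csubspace_tensor_maps: "csubspace (tensor_maps U W)"
  by (simp add: tensor_maps_def)

lemma tensor_maps_minimal:
  "csubspace V \<Longrightarrow> (\<And>T f. T \<in> U \<Longrightarrow> f \<in> W \<Longrightarrow> tensor_endo T f \<in> V) \<Longrightarrow> tensor_maps U W \<subseteq> V"
  unfolding tensor_maps_def by (rule complex_vector.span_minimal) auto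

lemma tensor_derivationI:
  assumes "\<And>x a y b. app F (tens (lie x y) (a * b))
      = lie (app F (tens x a)) (tens y b) + lie (tens x a) (app F (tens y b))"
  shows "F \<in> lie_derivations"
proof -
  have "app F (lie (tens x a) t) = lie (app F (tens x a)) t + lie (tens x a) (app F t)" for x a t
    by (induction t rule: tensor_induct) (simp_all add: assms lie_tens lie_add_right)
  then have "app F (lie s t) = lie (app F s) t + lie s (app F t)" for s t
    by (induction s rule: tensor_induct) (simp_all add: lie_add_left)
  then show ?thesis by (simp add: lie_derivations_def)
qed

lemma tensor_centroidI:
  assumes "\<And>x a y b. lie (tens x a) (app F (tens y b)) = app F (tens (lie x y) (a * b))"
  shows "F \<in> centroid"
proof (rule centroidI)
  have "lie (tens x a) (app F t) = app F (lie (tens x a) t)" for x a t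
    by (induction t rule: tensor_induct) (simp_all add: assms lie_tens lie_add_right)
  then show "lie s (app F t) = app F (lie s t)" for s t
    by (induction s rule: tensor_induct) (simp_all add: lie_add_left)
qed

lemma tensor_endo_derivation:
  "D \<in> lie_derivations \<Longrightarrow> tensor_endo D (mult_endo a) \<in> lie_derivations"
  by (rule tensor_derivationI) (simp add: derivation_lie lie_tens tens_simps ac_simps)

lemma tensor_endo_centroid_derivation:
  "T \<in> centroid \<Longrightarrow> d \<in> algebra_derivations \<Longrightarrow> tensor_endo T d \<in> lie_derivations"
  by (rule tensor_derivationI)
    (simp add: centroid_left centroid_right lie_tens tens_simps algebra_derivations_def)

lemma tensor_endo_central_derivation:
  assumes "K \<in> central_homs"
  shows "tensor_endo K f \<in> lie_derivations"
proof (rule tensor_derivationI)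
  fix x y a b
  have "lie x (app K y) = 0" "lie (app K x) y = 0"
    using central_homs_into_center[OF assms] lie_anticomm[of y "app K x"]
    by (simp_all add: lie_center_def)
  then show "app (tensor_endo K f) (tens (lie x y) (a * b))
      = lie (app (tensor_endo K f) (tens x a)) (tens y b) + lie (tens x a) (app (tensor_endo K f) (tens y b))"
    by (simp add: lie_tens central_homs_commutators[OF assms] lie_in_lie_product tens_simps)
qed

lemma tensor_endo_centroid: "T \<in> centroid \<Longrightarrow> tensor_endo T (mult_endo a) \<in> centroid"
  by (rule tensor_centroidI) (simp add: centroid_right lie_tens ac_simps)

lemma endo_id_centroid: "endo_id \<in> centroid"
  by (simp add: centroidI)

lemma tensor_endo_funpow:
  "(app (tensor_endo T f) ^^ n) (tens x b) = tens ((app T ^^ n) x) ((app f ^^ n) b)"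
  by (induction n) simp_all

lemma clinear_funpow: "clinear (app F ^^ n)"
  by (induction n) (auto intro: clinearI clinear_compose[OF clinear_app] simp: o_def)

lemma tensor_endo_funpow_zero:
  assumes "\<And>x b. tens ((app T ^^ n) x) ((app f ^^ n) b) = 0"
  shows "(app (tensor_endo T f) ^^ n) t = 0"
proof (induction t rule: tensor_induct)
  case zero
  show ?case by (simp add: clinear_zero[OF clinear_funpow])
next
  case (add s t)
  then show ?case by (simp add: clinear_add[OF clinear_funpow])
qed (simp add: tensor_endo_funpow assms)

lemma tensor_endo_nil_centroid:
  assumes "T \<in> nil_centroid"
  shows "tensor_endo T endo_id \<in> nil_centroid"
proof -
  obtain n where "\<forall>x. (app T ^^ n) x = 0"
    using assms by (auto simp: nil_centroid_def)
  then have "(app (tensor_endo T endo_id) ^^ n) t = 0" for t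
    by (intro tensor_endo_funpow_zero) (simp add: tens_simps)
  then show ?thesis
    using tensor_endo_centroid[OF nil_centroid_centroid[OF assms], of 1]
    by (auto simp: nil_centroid_def mult_endo_1)
qed

lemma tensor_endo_jacobson_nil_centroid:
  assumes fd: "finite_dim TYPE('a::complex_comm_algebra)" and a: "a \<in> jacobson_radical (UNIV :: 'a set)"
  shows "tensor_endo endo_id (mult_endo a) \<in> nil_centroid"
proof -
  obtain n where "a ^ n = 0"
    using jacobson_radical_nilpotent[OF assms] .
  then have "(app (tensor_endo endo_id (mult_endo a)) ^^ n) t = 0" for t
    by (intro tensor_endo_funpow_zero) (simp add: tens_simps funpow_mult_endo)
  then show ?thesis
    using tensor_endo_centroid[OF endo_id_centroid, of a] by (auto simp: nil_centroid_def)
qed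

text \<open>Bracketing with x \<otimes> 1 does not touch the second factor, so id \<otimes> f is
  equivariant for it whatever the functional f is.\<close>

lemma contract_lie_right:
  assumes "clinear f"
  shows "contract f (lie (tens x 1) t) = lie x (contract f t)"
proof (induction t rule: tensor_induct)
  case zero
  then show ?case by (simp add: clinear_zero[OF clinear_contract[OF assms]])
next
  case (add s t)
  then show ?case by (simp add: lie_add_right clinear_add[OF clinear_contract[OF assms]])
next
  case (tens y b)
  then show ?case by (simp add: lie_tens contract_tens[OF assms] lie_scale_right)
qed

lemma contract_lie_left:
  assumes "clinear f"
  shows "contract f (lie t (tens x 1)) = lie (contract f t) x"
  using contract_lie_right[OF assms, of x t]
  by (simp add: lie_anticomm[of _ "tens x 1"] lie_anticomm[of _ x] clinear_minus[OF clinear_contract[OF assms]])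

text \<open>[x, y] \<otimes> a = [x \<otimes> 1, y \<otimes> a].\<close>

lemma tens_commutator:
  assumes "x \<in> lie_product UNIV UNIV"
  shows "tens x (a :: 'a::complex_comm_algebra) \<in> lie_product UNIV UNIV"
proof -
  have "lie_product UNIV UNIV \<subseteq> {x. tens x a \<in> lie_product UNIV UNIV}"
  proof (rule lie_product_minimal)
    show "csubspace {x. tens x a \<in> lie_product UNIV UNIV}"
      by (rule csubspace_vimage[OF clinear_tens(2) csubspace_lie_product])
    show "lie x y \<in> {x. tens x a \<in> lie_product UNIV UNIV}" for x y
      using lie_in_lie_product[of "tens x 1" UNIV "tens y a" UNIV] by (simp add: lie_tens)
  qed
  then show ?thesis using assms by blast
qed

text \<open>By \<open>contract_lie_right\<close> the components of a central tensor are central in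
  the first factor, hence in its derived algebra. This transfers the hypothesis on the center to the
  current algebra, where the socle series is used.\<close>

lemma tensor_center_subset:
  assumes fd: "finite_dim TYPE('a::complex_comm_algebra)"
    and center: "(lie_center :: 'g::lie_algebra set) \<subseteq> lie_product UNIV UNIV"
  shows "(lie_center :: ('g, 'a) tensor set) \<subseteq> lie_product UNIV UNIV"
proof
  fix t :: "('g, 'a) tensor" assume t: "t \<in> lie_center"
  obtain B :: "'a set" where B: "finite B" "\<not> complex_vector.dependent B" "cspan B = UNIV"
    using finite_dim_basis[OF fd] .
  define r where "r b v = complex_vector.representation B v b" for b v
  have lin: "clinear (r b)" for b
    unfolding r_def by (rule clinear_representation[OF B(2,3)])
  have "lie x (contract (r b) t) = 0" for x b
    using t contract_lie_right[OF lin, of b x t]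
    by (simp add: lie_center_def clinear_zero[OF clinear_contract[OF lin]])
  then have "contract (r b) t \<in> lie_product UNIV UNIV" for b
    using center by (auto simp: lie_center_def)
  then have "(\<Sum>b\<in>B. tens (contract (r b) t) b) \<in> lie_product UNIV UNIV"
    by (intro complex_vector.subspace_sum csubspace_lie_product tens_commutator)
  then show "t \<in> lie_product UNIV UNIV"
    using tensor_basis_expansion[OF B, of t] by (simp add: r_def[abs_def])
qed

text \<open>For a basis element \<open>a\<close> and a coordinate functional \<open>f\<close> this
  is a matrix block of \<open>F\<close> along the second factor. As in \<open>rank_one\<close>, a
  nonlinear \<open>f\<close> gives 0.\<close>

lift_definition slice ::
    "('v::complex_vector, 'w::complex_vector) tensor endo \<Rightarrow> ('w \<Rightarrow> complex) \<Rightarrow> 'w \<Rightarrow> 'v endo"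
  is "\<lambda>F f a x. if clinear f then contract f (F (tens x a)) else 0"
proof -
  fix F :: "('v, 'w) tensor \<Rightarrow> ('v, 'w) tensor" and f :: "'w \<Rightarrow> complex" and a
  assume F: "clinear F"
  show "clinear (\<lambda>x. if clinear f then contract f (F (tens x a)) else 0)"
  proof (cases "clinear f")
    case True
    then show ?thesis
      by (simp add: clinear_compose[OF clinear_contract[OF True] clinear_compose[OF F clinear_tens(2)]])
  qed (simp add: clinearI)
qed

lemma app_slice [simp]: "clinear f \<Longrightarrow> app (slice F f a) x = contract f (app F (tens x a))"
  by (simp add: slice.rep_eq)

lemma slice_derivation:
  assumes F: "F \<in> lie_derivations" and f: "clinear f"
  shows "slice F f 1 \<in> lie_derivations"
proof -
  have "app (slice F f 1) (lie x y) = lie (app (slice F f 1) x) y + lie x (app (slice F f 1) y)" for x y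
    using derivation_lie[OF F, of "tens x 1" "tens y 1"]
    by (simp add: f lie_tens clinear_add[OF clinear_contract[OF f]] contract_lie_left[OF f]
        contract_lie_right[OF f])
  then show ?thesis by (simp add: lie_derivations_def)
qed

text \<open>Applying \<open>F\<close> to [x \<otimes> 1, y \<otimes> a] leaves only
  [x \<otimes> 1, F (y \<otimes> a)], so \<open>F\<close> commutes with bracketing by x \<otimes>
  1.\<close>

lemma slice_centroid:
  assumes F: "F \<in> lie_derivations" and F1: "\<And>x. app F (tens x 1) = 0" and f: "clinear f"
  shows "slice F f a \<in> centroid"
proof (rule centroidI)
  show "lie x (app (slice F f a) y) = app (slice F f a) (lie x y)" for x y
    using derivation_lie[OF F, of "tens x 1" "tens y a"]
    by (simp add: f F1 lie_tens contract_lie_right[OF f])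
qed

text \<open>A nonzero coefficient would put \<open>b\<close> into the span of the rest of
  \<open>B\<close>. With empty \<open>C\<close> this is plain independence; a nonempty
  \<open>C\<close> gives independence modulo its span.\<close>

lemma independent_coeff_zero:
  assumes B: "\<not> complex_vector.dependent B" and I: "finite I" "I \<subseteq> B" "C \<subseteq> B - I"
    and sum: "(\<Sum>b\<in>I. u b *\<^sub>C b) \<in> cspan C" and b: "b \<in> I"
  shows "u b = 0"
proof (rule ccontr)
  assume u: "u b \<noteq> 0"
  have "u b *\<^sub>C b = (\<Sum>b\<in>I. u b *\<^sub>C b) - (\<Sum>b\<in>I - {b}. u b *\<^sub>C b)"
    by (simp add: sum.remove[OF I(1) b])
  moreover have "(\<Sum>b\<in>I. u b *\<^sub>C b) \<in> cspan (B - {b})"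
    using complex_vector.span_mono[of C "B - {b}"] I(3) b sum by auto
  moreover have "(\<Sum>b\<in>I - {b}. u b *\<^sub>C b) \<in> cspan (B - {b})"
    using I(2) by (intro complex_vector.span_sum complex_vector.span_scale complex_vector.span_base) auto
  ultimately have "u b *\<^sub>C b \<in> cspan (B - {b})"
    by (simp only: complex_vector.span_diff)
  then have "inverse (u b) *\<^sub>C u b *\<^sub>C b \<in> cspan (B - {b})"
    by (rule complex_vector.span_scale)
  then have "b \<in> cspan (B - {b})"
    using u by (simp add: scaleC_scaleC scaleC_one)
  then show False
    using B b I(2) by (auto simp: complex_vector.dependent_def)
qed

text \<open>Zusmanovich's description of \<open>Der(g \<otimes> A)\<close>: a derivation vanishing on \<open>g \<otimes> 1\<close> lies in
  \<open>centroid \<otimes> End(A)\<close>, and expanding it along a basis of the centroid that extends one of the central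
  homomorphisms forces the remaining coefficients to be derivations of \<open>A\<close>.\<close>

lemma tensor_derivations:
  fixes F :: "('g::lie_algebra, 'a::complex_comm_algebra) tensor endo"
  assumes fd: "finite_dim TYPE('a)" and F: "F \<in> lie_derivations"
  shows "F \<in> tensor_maps lie_derivations (range mult_endo) + tensor_maps centroid algebra_derivations
    + tensor_maps central_homs UNIV"
proof -
  obtain B :: "'a set" where B: "finite B" "\<not> complex_vector.dependent B" "cspan B = UNIV"
    using finite_dim_basis[OF fd] .
  define r where "r b v = complex_vector.representation B v b" for b v
  have lin: "clinear (r b)" for b
    unfolding r_def by (rule clinear_representation[OF B(2,3)])
  have rep: "(\<Sum>b\<in>B. r b v *\<^sub>C b) = v" for v
    unfolding r_def by (rule sum_representation[OF B])
  have expand: "(\<Sum>b\<in>B. tens (contract (r b) t) b) = t" for t :: "('g, 'a) tensor"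
    using tensor_basis_expansion[OF B, of t] by (simp add: r_def[abs_def])
  \<comment> \<open>\<open>D\<close> is built from the components of F (x \<otimes> 1), so it agrees
    with \<open>F\<close> on all x \<otimes> 1.\<close>
  define D where "D = (\<Sum>b\<in>B. tensor_endo (slice F (r b) 1) (mult_endo b))"
  have D: "D \<in> tensor_maps lie_derivations (range mult_endo)"
    unfolding D_def by (intro complex_vector.subspace_sum csubspace_tensor_maps tensor_endo_in_maps
        slice_derivation[OF F lin] rangeI)
  define G where "G = F - D"
  have "D \<in> lie_derivations"
    using D tensor_maps_minimal[OF csubspace_derivations, of lie_derivations "range mult_endo"]
      tensor_endo_derivation by blast
  then have G: "G \<in> lie_derivations"
    unfolding G_def by (rule complex_vector.subspace_diff[OF csubspace_derivations F])
  have G1: "app G (tens x 1) = 0" for x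
    using expand[of "app F (tens x 1)"] by (simp add: G_def D_def lin)
  have "G = (\<Sum>c\<in>B. \<Sum>b\<in>B. tensor_endo (slice G (r b) c) (rank_one (r c) b))"
  proof (rule tensor_endo_eqI)
    fix x a
    have "app G (tens x a) = (\<Sum>c\<in>B. r c a *\<^sub>C app G (tens x c))"
      using arg_cong[OF rep[of a], of "\<lambda>a. app G (tens x a)"]
      by (simp add: clinear_sum[OF clinear_tens(1)] app_sum_right tens_simps)
    also have "\<dots> = (\<Sum>c\<in>B. r c a *\<^sub>C (\<Sum>b\<in>B. tens (contract (r b) (app G (tens x c))) b))"
      by (simp only: expand)
    also have "\<dots> = app (\<Sum>c\<in>B. \<Sum>b\<in>B. tensor_endo (slice G (r b) c) (rank_one (r c) b)) (tens x a)"
      by (simp add: lin tens_simps complex_vector.scale_sum_right)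
    finally show "app G (tens x a) = app (\<Sum>c\<in>B. \<Sum>b\<in>B. tensor_endo (slice G (r b) c) (rank_one (r c) b)) (tens x a)" .
  qed
  also have "\<dots> \<in> tensor_maps centroid UNIV"
    by (intro complex_vector.subspace_sum csubspace_tensor_maps tensor_endo_in_maps
        slice_centroid[OF G G1 lin] UNIV_I)
  finally have GC: "G \<in> tensor_maps centroid UNIV" .

  obtain BK where BK: "BK \<subseteq> (central_homs :: 'g endo set)" "\<not> complex_vector.dependent BK"
      "central_homs \<subseteq> cspan BK"
    using complex_vector.maximal_independent_subset[of central_homs] by blast
  obtain BC where BC: "BK \<subseteq> BC" "BC \<subseteq> centroid" "\<not> complex_vector.dependent BC" "centroid \<subseteq> cspan BC"
    using complex_vector.maximal_independent_subset_extend[of BK centroid] BK(1,2)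
      central_homs_centroid by (metis order_trans)
  obtain C f where C: "finite C" "C \<subseteq> BC" "G = (\<Sum>T\<in>C. tensor_endo T (f T))"
    by (rule cspan_bilinear_expansion[OF cbilinear_tensor_endo complex_vector.subspace_UNIV BC(4)
          GC[unfolded tensor_maps_def]])
  define I where "I = C - BK"
  define G' where "G' = (\<Sum>T\<in>I. tensor_endo T (f T))"
  define K where "K = (\<Sum>T\<in>C \<inter> BK. tensor_endo T (f T))"
  have GK: "G = G' + K"
    unfolding C(3) G'_def K_def I_def using C(1)
    by (subst sum.union_disjoint[symmetric]) (auto intro!: sum.cong)
  have K: "K \<in> tensor_maps central_homs UNIV"
    unfolding K_def using BK(1)
    by (intro complex_vector.subspace_sum csubspace_tensor_maps tensor_endo_in_maps) auto
  have "K \<in> lie_derivations"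
    using K tensor_maps_minimal[OF csubspace_derivations, of central_homs UNIV]
      tensor_endo_central_derivation by blast
  then have "G - K \<in> lie_derivations"
    by (rule complex_vector.subspace_diff[OF csubspace_derivations G])
  then have G': "G' \<in> lie_derivations"
    by (simp add: GK)
  have IC: "T \<in> centroid" if "T \<in> I" for T
    using that BC(2) C(2) by (auto simp: I_def)
  have f_der: "f T \<in> algebra_derivations" if T: "T \<in> I" for T
  proof -
    have "app (f T) (a * b) = app (f T) a * b + a * app (f T) b" for a b
    proof -
      define \<delta> where "\<delta> T = app (f T) (a * b) - (app (f T) a * b + a * app (f T) b)" for T
      have "r c (\<delta> T) = 0" for c
      proof -
        \<comment> \<open>The coefficients are the coordinates at \<open>c\<close> of the Leibniz
          defects. The derivation rule for \<open>G'\<close> makes \<open>Q\<close> vanish on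
          brackets, so \<open>Q\<close> lies in the span of \<open>BK\<close>, and the maps in
          \<open>I\<close> are independent modulo that span.\<close>
        define Q where "Q = (\<Sum>T\<in>I. r c (\<delta> T) *\<^sub>C T)"
        have "Q \<in> centroid"
          unfolding Q_def by (intro complex_vector.subspace_sum complex_vector.subspace_scale
              csubspace_centroid IC)
        moreover have "app Q (lie x y) = 0" for x y
        proof -
          have "(\<Sum>T\<in>I. tens (app T (lie x y)) (app (f T) (a * b)))
              = (\<Sum>T\<in>I. tens (app T (lie x y)) (app (f T) a * b))
                + (\<Sum>T\<in>I. tens (app T (lie x y)) (a * app (f T) b))"
          proof -
            have "app G' (tens (lie x y) (a * b))
                = lie (app G' (tens x a)) (tens y b) + lie (tens x a) (app G' (tens y b))"
              using derivation_lie[OF G', of "tens x a" "tens y b"] by (simp add: lie_tens)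
            moreover have "lie (\<Sum>T\<in>I. g T) t = (\<Sum>T\<in>I. lie (g T) t)" "lie t (\<Sum>T\<in>I. g T) = (\<Sum>T\<in>I. lie t (g T))"
              for g and t :: "('g, 'a) tensor"
              using cbilinear_lie by (auto simp: cbilinear_def intro: clinear_sum)
            ultimately show ?thesis
              by (simp add: G'_def lie_tens centroid_left[OF IC] centroid_right[OF IC] cong: sum.cong)
          qed
          then have "(\<Sum>T\<in>I. tens (app T (lie x y)) (\<delta> T)) = 0"
            unfolding \<delta>_def clinear_diff[OF clinear_tens(1)] tens_simps(2)
            by (simp add: sum_subtractf sum.distrib)
          then have "contract (r c) (\<Sum>T\<in>I. tens (app T (lie x y)) (\<delta> T)) = 0"
            by (simp add: clinear_zero[OF clinear_contract[OF lin]])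
          then show ?thesis
            by (simp add: Q_def clinear_sum[OF clinear_contract[OF lin]] contract_tens[OF lin])
        qed
        ultimately have "Q \<in> cspan BK"
          using centroid_kills_commutators BK(3) by blast
        then show ?thesis
          using independent_coeff_zero[OF BC(3), of I BK "\<lambda>T. r c (\<delta> T)" T] T C(1,2) BC(1)
          by (auto simp: Q_def I_def)
      qed
      then have "\<delta> T = 0"
        using rep[of "\<delta> T"] by simp
      then show ?thesis
        by (simp add: \<delta>_def)
    qed
    then show ?thesis
      by (simp add: algebra_derivations_def)
  qed
  have "G' \<in> tensor_maps centroid algebra_derivations"
    unfolding G'_def by (intro complex_vector.subspace_sum csubspace_tensor_maps tensor_endo_in_maps
        IC f_der)
  then have "D + G' + K \<in> tensor_maps lie_derivations (range mult_endo)
      + tensor_maps centroid algebra_derivations + tensor_maps central_homs UNIV"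
    by (intro set_plus_intro D K)
  then show ?thesis
    using GK by (simp add: G_def algebra_simps)
qed

section \<open>The radical of the derivation algebra\<close>

lemma lie_tensor_endo_mult:
  "lie (tensor_endo D (mult_endo a)) (tensor_endo E (mult_endo b)) = tensor_endo (lie D E) (mult_endo (a * b))"
proof -
  have "lie (mult_endo a) (mult_endo b) = 0"
    by (rule endo_eqI) (simp add: mult.left_commute)
  then show ?thesis
    by (simp add: lie_tensor_endo mult_endo_comp clinear_zero[OF clinear_tensor_endo(1)])
qed

text \<open>This bracket is used twice for a centroid element \<open>T\<close>. For the ideal
  property, [D,T] is again in the centroid and d(a) is in the Jacobson radical; for solvability,
  both summands are lowering.\<close>

lemma lie_tensor_endo_mult_derivation:
  assumes "d \<in> algebra_derivations"
  shows "lie (tensor_endo D (mult_endo a)) (tensor_endo T d)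
    = tensor_endo (lie D T) (mult_endo a \<odot> d) - tensor_endo (T \<odot> D) (mult_endo (app d a))"
  using lie_anticomm[of "mult_endo a" d]
  by (simp add: lie_tensor_endo lie_derivation_mult_endo[OF assms] clinear_minus[OF clinear_tensor_endo(1)])

lemma lie_tensor_maps_mem:
  assumes "csubspace V" "F \<in> tensor_maps U W" "G \<in> tensor_maps U' W'"
    and "\<And>T f T' f'. T \<in> U \<Longrightarrow> f \<in> W \<Longrightarrow> T' \<in> U' \<Longrightarrow> f' \<in> W' \<Longrightarrow> lie (tensor_endo T f) (tensor_endo T' f') \<in> V"
  shows "lie F G \<in> V"
  by (rule cspan_bilinear_mem[OF cbilinear_lie assms(1) assms(2,3)[unfolded tensor_maps_def]])
    (use assms(4) in auto)

lemma clinear_slice: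
  assumes "clinear f"
  shows "clinear (\<lambda>F. slice F f a)"
  by (rule clinearI; rule endo_eqI)
    (simp_all add: assms clinear_add[OF clinear_contract[OF assms]] clinear_scale[OF clinear_contract[OF assms]])

lemma slice_character:
  "algebra_character \<chi> \<Longrightarrow> slice (tensor_endo D (mult_endo a)) \<chi> 1 = \<chi> a *\<^sub>C D"
  by (rule endo_eqI) (simp add: algebra_character_def)

text \<open>The characters of \<open>A\<close> separate the points of \<open>S\<close>, so the Lie homomorphisms \<open>id \<otimes> \<chi>\<close> from
  \<open>\<ss> \<otimes> S\<close> onto \<open>\<ss>\<close> have trivial common kernel.\<close>

lemma lie_semisimple_tensor:
  fixes \<ss> :: "'g::lie_algebra endo set" and S :: "'a::complex_comm_algebra set"
  assumes fd: "finite_dim TYPE('a)" and S: "subalgebra S" "S \<inter> jacobson_radical UNIV = {0}"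
    and \<ss>: "lie_semisimple \<ss>"
  shows "lie_semisimple (tensor_maps \<ss> (mult_endo ` S))"
proof -
  define P where "P = tensor_maps \<ss> (mult_endo ` S)"
  have sub: "csubspace \<ss>" "\<And>x y. x \<in> \<ss> \<Longrightarrow> y \<in> \<ss> \<Longrightarrow> lie x y \<in> \<ss>"
    using \<ss> by (auto simp: lie_semisimple_def lie_subalgebra_def)
  have subP: "csubspace P"
    by (simp add: P_def csubspace_tensor_maps)
  have P: "lie_subalgebra P"
    unfolding lie_subalgebra_def
  proof (intro conjI ballI subP)
    show "lie F G \<in> P" if "F \<in> P" "G \<in> P" for F G
      by (rule lie_tensor_maps_mem[OF subP that[unfolded P_def]])
        (use S(1) sub(2) in \<open>auto simp: P_def lie_tensor_endo_mult subalgebra_def intro!: tensor_endo_in_maps\<close>)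
  qed
  have "H \<subseteq> {0}" if H: "lie_ideal H P" "lie_solvable H" for H
  proof
    have HP: "H \<subseteq> P" and subH: "csubspace H" using H(1) by (auto simp: lie_ideal_def)
    have \<phi>0: "slice F \<chi> 1 = 0" if \<chi>: "algebra_character \<chi>" and F: "F \<in> H" for \<chi> F
    proof -
      define \<phi> where "\<phi> F = slice F \<chi> 1" for F :: "('g, 'a) tensor endo"
      have lin\<chi>: "clinear \<chi>" using \<chi> by (simp add: algebra_character_def)
      have lin: "clinear \<phi>" unfolding \<phi>_def by (rule clinear_slice[OF lin\<chi>])
      have \<phi>s: "\<phi> F \<in> \<ss>" if "F \<in> P" for F
        by (rule cspan_linear_mem[OF lin sub(1) that[unfolded P_def tensor_maps_def]])
          (auto simp: \<phi>_def slice_character[OF \<chi>] complex_vector.subspace_scale[OF sub(1)])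
      have hom: "\<phi> (lie F G) = lie (\<phi> F) (\<phi> G)" if "F \<in> P" "G \<in> P" for F G
      proof -
        have "\<phi> (lie F G) - lie (\<phi> F) (\<phi> G) \<in> {0}"
        proof (rule cspan_bilinear_mem[where h = "\<lambda>F G. \<phi> (lie F G) - lie (\<phi> F) (\<phi> G)",
              OF _ _ that[unfolded P_def tensor_maps_def]])
          show "cbilinear (\<lambda>F G. \<phi> (lie F G) - lie (\<phi> F) (\<phi> G))"
            unfolding cbilinear_def by (intro conjI allI clinearI)
              (simp_all add: lie_add_left lie_add_right lie_scale_left lie_scale_right
                clinear_add[OF lin] clinear_scale[OF lin] complex_vector.scale_right_diff_distrib)
          have mult: "\<chi> (a * b) = \<chi> a * \<chi> b" for a b
            using \<chi> by (simp add: algebra_character_def)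
          show "\<phi> (lie F G) - lie (\<phi> F) (\<phi> G) \<in> {0}"
            if "F \<in> {tensor_endo T f |T f. T \<in> \<ss> \<and> f \<in> mult_endo ` S}"
              "G \<in> {tensor_endo T f |T f. T \<in> \<ss> \<and> f \<in> mult_endo ` S}" for F G
            using that by (auto simp: \<phi>_def lie_tensor_endo_mult slice_character[OF \<chi>] mult
                lie_scale_left lie_scale_right scaleC_scaleC)
        qed simp
        then show ?thesis by simp
      qed
      have "lie_ideal (\<phi> ` H) \<ss>"
        unfolding lie_ideal_def
      proof (intro conjI ballI)
        show "csubspace (\<phi> ` H)" by (rule csubspace_image[OF lin subH])
        show "\<phi> ` H \<subseteq> \<ss>" using HP \<phi>s by auto
        fix x y assume x: "x \<in> \<ss>" and "y \<in> \<phi> ` H"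
        then obtain G where G: "y = \<phi> G" "G \<in> H" by auto
        \<comment> \<open>Since 1 is in \<open>S\<close> and has character value 1, \<open>X\<close>
          is a preimage of \<open>x\<close>; so the image of \<open>H\<close> is an ideal of all of
          \<ss>.\<close>
        define X where "X = tensor_endo x (mult_endo (1 :: 'a))"
        have X: "X \<in> P" "\<phi> X = x"
          using x S(1) \<chi> unfolding X_def \<phi>_def slice_character[OF \<chi>]
          by (auto simp: P_def subalgebra_def algebra_character_def scaleC_one intro!: tensor_endo_in_maps)
        then have "lie x y = \<phi> (lie X G)"
          using G HP by (auto simp: hom)
        then show "lie x y \<in> \<phi> ` H"
          using H(1) X(1) G(2) by (auto simp: lie_ideal_def)
      qed
      moreover have "lie_solvable (\<phi> ` H)"
      proof -
        obtain n where n: "derived_series n H = {0}"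
          using H(2) by (auto simp: lie_solvable_def)
        have subder: "derived_series k H \<subseteq> P" for k
          using derived_series_subset[OF lie_subalgebra_ideal[OF H(1)]] HP by blast
        have "derived_series k (\<phi> ` H) \<subseteq> \<phi> ` derived_series k H" for k
        proof (induction k)
          case (Suc k)
          have "lie_product (derived_series k (\<phi> ` H)) (derived_series k (\<phi> ` H))
              \<subseteq> \<phi> ` lie_product (derived_series k H) (derived_series k H)"
          proof (rule lie_product_minimal[OF csubspace_image[OF lin csubspace_lie_product]])
            fix x y assume "x \<in> derived_series k (\<phi> ` H)" "y \<in> derived_series k (\<phi> ` H)"
            then obtain F G where FG: "x = \<phi> F" "y = \<phi> G" "F \<in> derived_series k H" "G \<in> derived_series k H"
              using Suc by blast
            have "lie x y = \<phi> (lie F G)"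
              using hom[OF subsetD[OF subder FG(3)] subsetD[OF subder FG(4)]] by (simp add: FG(1,2))
            then show "lie x y \<in> \<phi> ` lie_product (derived_series k H) (derived_series k H)"
              using lie_in_lie_product[OF FG(3,4)] by blast
          qed
          then show ?case by simp
        qed simp
        from this[of n] have "derived_series n (\<phi> ` H) \<subseteq> {0}"
          by (simp add: n clinear_zero[OF lin])
        then show ?thesis
          by (intro derived_series_into_solvable[of _ n "{0}" 0] lie_subalgebra_ideal)
            (use \<open>lie_ideal (\<phi> ` H) \<ss>\<close> in auto)
      qed
      ultimately have "\<phi> ` H \<subseteq> {0}"
        using \<ss> by (auto simp: lie_semisimple_def is_lie_radical_def)
      then show ?thesis
        using F by (auto simp: \<phi>_def)
    qed
    fix F assume F: "F \<in> H"
    obtain B where B: "B \<subseteq> \<ss>" "\<not> complex_vector.dependent B" "\<ss> \<subseteq> cspan B"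
      using complex_vector.maximal_independent_subset[of \<ss>] by blast
    have subS: "csubspace (mult_endo ` S)"
      using S(1) by (intro csubspace_image clinear_mult_endo) (simp add: subalgebra_def)
    \<comment> \<open>Along a basis of \<ss> the element \<open>F\<close> has coefficients in
      \<open>S\<close>. Every character annihilates each of them, so they lie in the Jacobson
      radical as well and vanish.\<close>
    obtain C w where C: "finite C" "C \<subseteq> B" "\<And>b. w b \<in> mult_endo ` S" "F = (\<Sum>b\<in>C. tensor_endo b (w b))"
      by (rule cspan_bilinear_expansion[OF cbilinear_tensor_endo subS B(3), of F])
        (use F HP in \<open>auto simp: P_def tensor_maps_def\<close>)
    obtain a where a: "\<And>b. a b \<in> S" "\<And>b. w b = mult_endo (a b)"
      using C(3) unfolding image_iff by metis
    have "a b = 0" if b: "b \<in> C" for b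
    proof -
      have "\<chi> (a b) = 0" if \<chi>: "algebra_character \<chi>" for \<chi>
      proof -
        have "(\<Sum>b\<in>C. \<chi> (a b) *\<^sub>C b) = slice F \<chi> 1"
          using \<chi> unfolding C(4) by (subst clinear_sum[OF clinear_slice])
            (simp_all add: algebra_character_def a(2) slice_character[OF \<chi>])
        then have "(\<Sum>b\<in>C. \<chi> (a b) *\<^sub>C b) \<in> cspan {}"
          using \<phi>0[OF \<chi> F] by simp
        then show ?thesis
          using independent_coeff_zero[OF B(2) C(1,2), of "{}" "\<lambda>b. \<chi> (a b)"] b by blast
      qed
      then have "a b \<in> jacobson_radical UNIV"
        by (rule characters_separate[OF fd])
      then show ?thesis using a(1) S(2) by blast
    qed
    then show "F \<in> {0}"
      by (simp add: C(4) a(2) clinear_zero[OF clinear_mult_endo] clinear_zero[OF clinear_tensor_endo(1)])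
  qed
  moreover have "lie_ideal {0} P" "lie_solvable {0}"
    using complex_vector.subspace_0[OF subP]
    by (auto simp: lie_ideal_def lie_solvable_def lie_subalgebra_def intro: exI[of _ 0])
  ultimately show ?thesis
    using P by (auto simp: lie_semisimple_def is_lie_radical_def P_def)
qed

section \<open>The claimed radical is a solvable ideal with complement \<ss> \<otimes> S\<close>

lemma algebra_derivation_jacobson_radical:
  "finite_dim TYPE('a::complex_comm_algebra) \<Longrightarrow> d \<in> algebra_derivations \<Longrightarrow> app d a \<in> jacobson_radical (UNIV :: 'a set)"
  by (metis derivation_nilpotent nilpotent_in_jacobson_radical)

text \<open>Derivations and centroid elements preserve the derived algebra and the center, so
  composing \<open>K\<close> with them on either side gives central homomorphisms, whatever happens
  in the second factor.\<close>

lemma lie_central_homs_tensor: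
  assumes K: "K \<in> central_homs" and F: "F \<in> lie_derivations \<union> centroid"
  shows "lie (tensor_endo K f) (tensor_endo F g) \<in> tensor_maps central_homs UNIV"
proof -
  have "K \<odot> F \<in> central_homs"
    by (rule central_homs_comp(1)[OF K]) (use F derivation_commutators centroid_commutators in blast)
  moreover have "F \<odot> K \<in> central_homs"
    by (rule central_homs_comp(2)[OF K]) (use F derivation_center centroid_center in blast)
  ultimately show ?thesis
    unfolding lie_conv_comp tensor_endo_comp
    by (intro complex_vector.subspace_diff csubspace_tensor_maps tensor_endo_in_maps UNIV_I)
qed

text \<open>The sets \<open>D\<close> and \<open>D'\<close> are arbitrary so that each term of the
  derived series of Der(A) can be inserted.\<close>

lemma lie_centroid_tensor:
  assumes "T \<in> centroid" "T' \<in> centroid" "d \<in> D" "d' \<in> D'"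
  shows "lie (tensor_endo T d) (tensor_endo T' d')
    \<in> tensor_maps centroid (lie_product D D') + tensor_maps central_homs UNIV"
proof -
  have "tensor_endo (T' \<odot> T) (lie d d') + tensor_endo (lie T T') (d \<odot> d')
      \<in> tensor_maps centroid (lie_product D D') + tensor_maps central_homs UNIV"
    using assms by (intro set_plus_intro tensor_endo_in_maps centroid_comp lie_in_lie_product
        lie_centroid_central UNIV_I)
  then show ?thesis
    by (simp add: lie_tensor_endo add.commute)
qed

lemma set_plus_subset:
  fixes U V W :: "'v::complex_vector set"
  assumes "csubspace V" "U \<subseteq> V" "W \<subseteq> V"
  shows "U + W \<subseteq> V"
  using assms complex_vector.subspace_add[OF assms(1)] by (force elim!: set_plus_elim)

lemma set_plus_mem: "csubspace U \<Longrightarrow> csubspace W \<Longrightarrow> x \<in> U \<or> x \<in> W \<Longrightarrow> x \<in> U + W"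
  using subset_set_plus by blast

lemma lie_ideal_current:
  fixes \<ss> \<rr> :: "'g::lie_algebra endo set"
  defines "\<JJ> \<equiv> jacobson_radical (UNIV :: 'a::complex_comm_algebra set)"
  assumes fd: "finite_dim TYPE('a)"
    and \<rr>: "lie_ideal \<rr> lie_derivations" and \<ss>: "\<ss> + \<rr> = lie_derivations" "csubspace \<ss>"
  shows "lie_ideal (tensor_maps \<ss> (mult_endo ` \<JJ>) + tensor_maps \<rr> (range mult_endo)
        + tensor_maps centroid algebra_derivations + tensor_maps central_homs UNIV)
      (lie_derivations :: ('g, 'a) tensor endo set)" (is "lie_ideal ?I ?L")
proof -
  note subs = csubspace_plus csubspace_tensor_maps
  have subI: "csubspace ?I"
    by (intro subs)
  note in_I = set_plus_mem[OF csubspace_plus[OF csubspace_plus[OF csubspace_tensor_maps csubspace_tensor_maps] csubspace_tensor_maps] csubspace_tensor_maps]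
    set_plus_mem[OF csubspace_plus[OF csubspace_tensor_maps csubspace_tensor_maps] csubspace_tensor_maps]
    set_plus_mem[OF csubspace_tensor_maps csubspace_tensor_maps]
  have I1: "F \<in> ?I" if "F \<in> tensor_maps \<ss> (mult_endo ` \<JJ>)" for F
    using that by (intro in_I disjI1)
  have I2: "F \<in> ?I" if "F \<in> tensor_maps \<rr> (range mult_endo)" for F
    using that by (intro in_I(1) disjI1 in_I(2) in_I(3) disjI2)
  have I3: "F \<in> ?I" if "F \<in> tensor_maps centroid algebra_derivations" for F
    using that by (intro in_I(1) disjI1 in_I(2) disjI2)
  have I4: "F \<in> ?I" if "F \<in> tensor_maps central_homs UNIV" for F
    using that by (intro in_I(1) disjI2)
  have \<ss>L: "\<ss> \<subseteq> lie_derivations" and \<rr>L: "\<rr> \<subseteq> lie_derivations" and sub\<rr>: "csubspace \<rr>"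
    using \<rr> \<ss>(1) subset_set_plus[OF \<ss>(2), of \<rr>] by (auto simp: lie_ideal_def)
  have J: "ring_ideal_of \<JJ> UNIV"
    unfolding \<JJ>_def by (rule jacobson_radical_ideal)
  \<comment> \<open>The claimed ideal contains all of Der(g) \<otimes> \<JJ>: the \<ss>-part is the
    first summand and the \<rr>-part lies in \<rr> \<otimes> A.\<close>
  have IJ: "tensor_endo D (mult_endo j) \<in> ?I" if D: "D \<in> lie_derivations" and j: "j \<in> \<JJ>" for D j
  proof -
    obtain x y where xy: "D = x + y" "x \<in> \<ss>" "y \<in> \<rr>"
      using D unfolding \<ss>(1)[symmetric] by (rule set_plus_elim)
    have "tensor_endo x (mult_endo j) \<in> ?I"
      by (intro I1 tensor_endo_in_maps xy imageI j)
    moreover have "tensor_endo y (mult_endo j) \<in> ?I"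
      by (intro I2 tensor_endo_in_maps xy rangeI)
    ultimately show ?thesis
      unfolding xy clinear_add[OF clinear_tensor_endo(2)] by (rule complex_vector.subspace_add[OF subI])
  qed
  have DC: "lie (tensor_endo D (mult_endo a)) (tensor_endo T d) \<in> ?I"
    if "D \<in> lie_derivations" "T \<in> centroid" "d \<in> algebra_derivations" for D a T d
    unfolding lie_tensor_endo_mult_derivation[OF that(3)]
  proof (rule complex_vector.subspace_diff[OF subI])
    show "tensor_endo (lie D T) (mult_endo a \<odot> d) \<in> ?I"
      by (intro I3 tensor_endo_in_maps lie_derivation_centroid algebra_derivation_comp_mult that)
    show "tensor_endo (T \<odot> D) (mult_endo (app d a)) \<in> ?I"
      unfolding \<JJ>_def[symmetric]
      by (intro IJ centroid_comp_derivation that)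
        (simp add: \<JJ>_def algebra_derivation_jacobson_radical[OF fd that(3)])
  qed
  have anti: "lie G F \<in> ?I" if "lie F G \<in> ?I" for F G
    using complex_vector.subspace_neg[OF subI that] lie_anticomm[of G F] by simp
  have CC: "lie (tensor_endo T d) (tensor_endo T' d') \<in> ?I"
    if "T \<in> centroid" "d \<in> algebra_derivations" "T' \<in> centroid" "d' \<in> algebra_derivations" for T d T' d'
  proof -
    have "lie_product (algebra_derivations :: 'a endo set) algebra_derivations \<subseteq> algebra_derivations"
      using derived_series_subset[OF lie_subalgebra_algebra_derivations, of 1] by simp
    then have "tensor_maps (centroid :: 'g endo set) (lie_product (algebra_derivations :: 'a endo set) algebra_derivations) \<subseteq> ?I"
      by (intro tensor_maps_minimal subI) (blast intro: I3 tensor_endo_in_maps)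
    moreover have "tensor_maps central_homs UNIV \<subseteq> ?I"
      using I4 by blast
    ultimately show ?thesis
      using lie_centroid_tensor[OF that(1,3,2,4)] set_plus_subset[OF subI] by (meson subsetD)
  qed
  have K: "lie (tensor_endo K f) (tensor_endo F g) \<in> ?I" if "K \<in> central_homs" "F \<in> lie_derivations \<union> centroid"
    for K F f g
    using lie_central_homs_tensor[OF that] by (rule I4)
  \<comment> \<open>By bilinearity it suffices to bracket generators. By
    \<open>tensor_derivations\<close>, \<open>?GL\<close> spans all derivations of the current
    algebra.\<close>
  let ?GL = "{tensor_endo D f |D f. D \<in> lie_derivations \<and> f \<in> range mult_endo}
    \<union> {tensor_endo T d |T d. T \<in> centroid \<and> d \<in> algebra_derivations}
    \<union> {tensor_endo K f |K f. K \<in> central_homs \<and> f \<in> UNIV} :: ('g, 'a) tensor endo set"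
  let ?GI = "{tensor_endo D f |D f. D \<in> \<ss> \<and> f \<in> mult_endo ` \<JJ>}
    \<union> {tensor_endo D f |D f. D \<in> \<rr> \<and> f \<in> range mult_endo}
    \<union> {tensor_endo T d |T d. T \<in> centroid \<and> d \<in> algebra_derivations}
    \<union> {tensor_endo K f |K f. K \<in> central_homs \<and> f \<in> UNIV} :: ('g, 'a) tensor endo set"
  have GI: "?I = cspan ?GI"
    by (simp only: tensor_maps_def cspan_union_plus)
  have brackets: "lie F G \<in> ?I" if F: "F \<in> ?GL" and G: "G \<in> ?GI" for F G
  proof -
    have sJ: "lie F (tensor_endo D (mult_endo j)) \<in> ?I" if D: "D \<in> \<ss>" and j: "j \<in> \<JJ>" for D j
    proof -
      have DL: "D \<in> lie_derivations" using D \<ss>L by blast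
      from F consider E a where "F = tensor_endo E (mult_endo a)" "E \<in> lie_derivations"
        | T d where "F = tensor_endo T d" "T \<in> centroid" "d \<in> algebra_derivations"
        | K f where "F = tensor_endo K f" "K \<in> central_homs" by blast
      then show ?thesis
      proof cases
        case 1
        have "lie E D \<in> lie_derivations" "a * j \<in> \<JJ>"
          using 1 DL J j lie_subalgebra_derivations by (auto simp: lie_subalgebra_def ring_ideal_of_def)
        then show ?thesis unfolding 1 lie_tensor_endo_mult by (rule IJ)
      next
        case 2
        show ?thesis unfolding 2 by (rule anti[OF DC[OF DL 2(2,3)]])
      next
        case 3
        show ?thesis unfolding 3 by (rule K[OF 3(2)]) (use DL in blast)
      qed
    qed
    have rA: "lie F (tensor_endo D (mult_endo b)) \<in> ?I" if D: "D \<in> \<rr>" for D b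
    proof -
      have DL: "D \<in> lie_derivations" using D \<rr>L by blast
      from F consider E a where "F = tensor_endo E (mult_endo a)" "E \<in> lie_derivations"
        | T d where "F = tensor_endo T d" "T \<in> centroid" "d \<in> algebra_derivations"
        | K f where "F = tensor_endo K f" "K \<in> central_homs" by blast
      then show ?thesis
      proof cases
        case 1
        have "lie E D \<in> \<rr>"
          using 1 D \<rr> by (auto simp: lie_ideal_def)
        then show ?thesis unfolding 1 lie_tensor_endo_mult by (intro I2 tensor_endo_in_maps rangeI)
      next
        case 2
        show ?thesis unfolding 2 by (rule anti[OF DC[OF DL 2(2,3)]])
      next
        case 3
        show ?thesis unfolding 3 by (rule K[OF 3(2)]) (use DL in blast)
      qed
    qed
    have Cd: "lie F (tensor_endo T d) \<in> ?I" if "T \<in> centroid" "d \<in> algebra_derivations" for T d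
      using F that DC CC K by blast
    have Kf: "lie F (tensor_endo K' f) \<in> ?I" if "K' \<in> central_homs" for K' f
      using F that central_homs_centroid by (blast intro: anti K)
    show ?thesis
      using G sJ rA Cd Kf by blast
  qed
  have L: "?L \<subseteq> cspan ?GL"
    using tensor_derivations[OF fd] by (auto simp: tensor_maps_def cspan_union_plus)
  have "?GI \<subseteq> ?L"
    using \<ss>L \<rr>L tensor_endo_derivation tensor_endo_centroid_derivation tensor_endo_central_derivation
    by blast
  then have "?I \<subseteq> ?L"
    unfolding GI by (rule complex_vector.span_minimal[OF _ csubspace_derivations])
  moreover have "lie F G \<in> ?I" if "F \<in> ?L" "G \<in> ?I" for F G
    by (rule cspan_bilinear_mem[OF cbilinear_lie subI subsetD[OF L that(1)] that(2)[unfolded GI]])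
      (rule brackets)
  ultimately show ?thesis
    unfolding lie_ideal_def using subI by blast
qed

lemma derived_series_zero_mono:
  assumes L: "lie_subalgebra L" and "derived_series m L = {0}" "m \<le> n"
  shows "derived_series n L = {0}"
proof -
  have "derived_series n L = derived_series (n - m) (derived_series m L)"
    using assms(3) by (simp flip: derived_series_add)
  also have "\<dots> \<subseteq> {0}"
    unfolding assms(2) by (rule derived_series_subset) (simp add: lie_subalgebra_def)
  finally show ?thesis
    using L zero_in_derived_series[of L n] by (auto simp: lie_subalgebra_def)
qed

text \<open>Modulo lowering maps the derived series descends in \<rr> and in Der(A) at the same
  time. The summands \<ss> \<otimes> \<JJ> and central homs \<otimes> End(A) are lowering from the
  start.\<close>

lemma lie_solvable_current:
  fixes \<ss> \<rr> :: "'g::lie_algebra endo set"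
  defines "\<JJ> \<equiv> jacobson_radical (UNIV :: 'a::complex_comm_algebra set)"
  defines "I \<equiv> tensor_maps \<ss> (mult_endo ` \<JJ>) + tensor_maps \<rr> (range mult_endo)
        + tensor_maps centroid algebra_derivations + tensor_maps central_homs UNIV"
  assumes fda: "finite_dim TYPE('a)" and fdg: "finite_dim TYPE('g)"
    and center: "(lie_center :: 'g set) \<subseteq> lie_product UNIV UNIV"
    and \<ss>: "\<ss> \<subseteq> lie_derivations" and \<rr>: "\<rr> \<subseteq> lie_derivations" "lie_solvable \<rr>"
    and der: "lie_solvable (algebra_derivations :: 'a endo set)"
    and I: "lie_subalgebra I"
  shows "lie_solvable I"
proof -
  note fd = finite_dim_tensor[OF fdg fda]
  note center_h = tensor_center_subset[OF fda center]
  let ?N = "lowering :: ('g, 'a) tensor endo set"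
  have idN: "lie_ideal ?N lie_derivations"
    by (rule lie_ideal_lowering[OF fd center_h])
  then have subN: "csubspace ?N" by (simp add: lie_ideal_def)
  \<comment> \<open>D \<otimes> j is the derivation D \<otimes> 1 followed by id \<otimes> j, which
    is nilpotent because j is.\<close>
  have NJ: "tensor_endo D (mult_endo j) \<in> ?N" if "D \<in> lie_derivations" "j \<in> \<JJ>" for D j
  proof -
    have "tensor_endo endo_id (mult_endo j) \<odot> tensor_endo D (mult_endo 1) \<in> ?N"
      using nil_centroid_comp_derivation[OF fd center_h tensor_endo_derivation[OF that(1)]
          tensor_endo_jacobson_nil_centroid[OF fda]] that(2) by (simp add: \<JJ>_def)
    moreover have "endo_id \<odot> D = D" by (rule endo_eqI) simp
    ultimately show ?thesis by (simp add: tensor_endo_comp mult_endo_comp)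
  qed
  \<comment> \<open>Here the derivation id \<otimes> d is followed by the nilpotent T \<otimes>
    id.\<close>
  have NN: "tensor_endo T d \<in> ?N" if "T \<in> nil_centroid" "d \<in> algebra_derivations" for T d
  proof -
    have "tensor_endo T endo_id \<odot> tensor_endo endo_id d \<in> ?N"
      by (intro nil_centroid_comp_derivation[OF fd center_h] tensor_endo_nil_centroid that
          tensor_endo_centroid_derivation endo_id_centroid)
    moreover have "T \<odot> endo_id = T" "endo_id \<odot> d = d" by (rule endo_eqI; simp)+
    ultimately show ?thesis by (simp add: tensor_endo_comp)
  qed
  have NK: "tensor_maps central_homs UNIV \<subseteq> ?N"
  proof (rule tensor_maps_minimal[OF subN])
    fix K :: "'g endo" and f :: "'a endo" assume K: "K \<in> central_homs"
    have "app (tensor_endo K f) t \<in> lie_center" for t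
    proof (induction t rule: tensor_induct)
      case (tens x b)
      have "lie s (tens (app K x) c) = 0" for s :: "('g, 'a) tensor" and c
        using central_homs_into_center[OF K, of x]
        by (induction s rule: tensor_induct) (simp_all add: lie_add_left lie_tens lie_center_def tens_simps)
      then show ?case by (simp add: lie_center_def)
    qed (simp_all add: complex_vector.subspace_0 complex_vector.subspace_add csubspace_center)
    then show "tensor_endo K f \<in> ?N"
      by (intro into_center_lowering tensor_endo_central_derivation K)
  qed

  define X where "X n = ?N \<union> {tensor_endo D f |D f. D \<in> derived_series n \<rr> \<and> f \<in> range mult_endo}
    \<union> {tensor_endo T d |T d. T \<in> centroid \<and> d \<in> derived_series n algebra_derivations}" for n
  have \<rr>n: "derived_series n \<rr> \<subseteq> lie_derivations" for n
    using derived_series_subset[of \<rr> n] \<rr> by (auto simp: lie_solvable_def)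
  have dn: "derived_series n algebra_derivations \<subseteq> (algebra_derivations :: 'a endo set)" for n
    by (rule derived_series_subset[OF lie_subalgebra_algebra_derivations])
  have X1: "F \<in> cspan (X n)" if "F \<in> ?N" for F n
    using that by (intro complex_vector.span_base) (simp add: X_def)
  have X2: "tensor_endo D (mult_endo a) \<in> cspan (X n)" if "D \<in> derived_series n \<rr>" for D a n
    using that by (intro complex_vector.span_base) (auto simp: X_def)
  have X3: "tensor_endo T d \<in> cspan (X n)" if "T \<in> centroid" "d \<in> derived_series n algebra_derivations" for T d n
    using that by (intro complex_vector.span_base) (auto simp: X_def)
  have XL: "X n \<subseteq> lie_derivations" for n
    using \<rr>n[of n] dn[of n] tensor_endo_derivation tensor_endo_centroid_derivation lowering_derivation
    unfolding X_def by blast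
  have DC: "lie (tensor_endo D (mult_endo a)) (tensor_endo T d) \<in> ?N"
    if "D \<in> lie_derivations" "T \<in> centroid" "d \<in> algebra_derivations" for D a T d
    unfolding lie_tensor_endo_mult_derivation[OF that(3)]
    by (intro complex_vector.subspace_diff[OF subN] NN NJ lie_derivation_nil_centroid fdg center that
        algebra_derivation_comp_mult centroid_comp_derivation)
      (simp add: \<JJ>_def algebra_derivation_jacobson_radical[OF fda that(3)])
  have brackets: "lie F G \<in> cspan (X (Suc n))" if F: "F \<in> X n" and G: "G \<in> X n" for F G n
  proof (cases "F \<in> ?N \<or> G \<in> ?N")
    case True
    have "F \<in> lie_derivations" "G \<in> lie_derivations"
      using F G XL by auto
    then have "lie F G \<in> ?N"
      using True idN lie_ideal_lie_right[OF idN] by (auto simp: lie_ideal_def)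
    then show ?thesis by (rule X1)
  next
    case False
    have CC: "lie (tensor_endo T d) (tensor_endo T' d') \<in> cspan (X (Suc n))"
      if "T \<in> centroid" "d \<in> derived_series n algebra_derivations"
        "T' \<in> centroid" "d' \<in> derived_series n algebra_derivations" for T d T' d'
    proof -
      have "tensor_maps centroid (lie_product (derived_series n algebra_derivations) (derived_series n algebra_derivations))
          \<subseteq> cspan (X (Suc n))"
        by (intro tensor_maps_minimal X3) simp_all
      moreover have "tensor_maps central_homs UNIV \<subseteq> cspan (X (Suc n))"
        using NK X1 by blast
      ultimately show ?thesis
        using lie_centroid_tensor[OF that(1,3,2,4)] set_plus_subset[OF complex_vector.subspace_span]
        by (meson subsetD)
    qed
    have DD: "lie (tensor_endo D (mult_endo a)) (tensor_endo E (mult_endo b)) \<in> cspan (X (Suc n))"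
      if "D \<in> derived_series n \<rr>" "E \<in> derived_series n \<rr>" for D E a b
      unfolding lie_tensor_endo_mult using that by (intro X2) (simp add: lie_in_lie_product)
    have DC': "lie (tensor_endo D (mult_endo a)) (tensor_endo T d) \<in> cspan (X (Suc n))"
      "lie (tensor_endo T d) (tensor_endo D (mult_endo a)) \<in> cspan (X (Suc n))"
      if "D \<in> derived_series n \<rr>" "T \<in> centroid" "d \<in> derived_series n algebra_derivations" for D a T d
    proof -
      have N: "lie (tensor_endo D (mult_endo a)) (tensor_endo T d) \<in> ?N"
        using that \<rr>n dn by (intro DC) auto
      then show "lie (tensor_endo D (mult_endo a)) (tensor_endo T d) \<in> cspan (X (Suc n))"
        by (rule X1)
      have "lie (tensor_endo T d) (tensor_endo D (mult_endo a)) \<in> ?N"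
        using complex_vector.subspace_neg[OF subN N] lie_anticomm[of "tensor_endo T d" "tensor_endo D (mult_endo a)"] by simp
      then show "lie (tensor_endo T d) (tensor_endo D (mult_endo a)) \<in> cspan (X (Suc n))"
        by (rule X1)
    qed
    show ?thesis
      using F G False CC DD DC' unfolding X_def by blast
  qed
  have derI: "derived_series n I \<subseteq> cspan (X n)" for n
  proof (induction n)
    case 0
    have "tensor_maps \<ss> (mult_endo ` \<JJ>) \<subseteq> cspan (X 0)"
      using \<ss> NJ X1 by (intro tensor_maps_minimal) blast+
    moreover have "tensor_maps \<rr> (range mult_endo) \<subseteq> cspan (X 0)"
      using X2[of _ 0] by (intro tensor_maps_minimal) auto
    moreover have "tensor_maps centroid algebra_derivations \<subseteq> cspan (X 0)"
      using X3[of _ _ 0] by (intro tensor_maps_minimal) auto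
    moreover have "tensor_maps central_homs UNIV \<subseteq> cspan (X 0)"
      using NK X1 by blast
    ultimately show ?case
      unfolding I_def by (auto elim!: set_plus_elim intro!: complex_vector.span_add)
  next
    case (Suc n)
    have "lie_product (derived_series n I) (derived_series n I) \<subseteq> cspan (X (Suc n))"
      by (rule lie_product_minimal, simp, rule cspan_bilinear_mem[OF cbilinear_lie, where X = "X n" and Y = "X n"])
        (use Suc brackets in auto)
    then show ?case by simp
  qed
  \<comment> \<open>At the index p + q both derived series have vanished, so only the lowering
    generators remain in \<open>X (p + q)\<close>.\<close>
  obtain p q where "derived_series p \<rr> = {0}" "derived_series q (algebra_derivations :: 'a endo set) = {0}"
    using \<rr>(2) der by (auto simp: lie_solvable_def)
  then have "derived_series (p + q) \<rr> = {0}" "derived_series (p + q) (algebra_derivations :: 'a endo set) = {0}"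
    using derived_series_zero_mono[of \<rr> p "p + q"] derived_series_zero_mono[of algebra_derivations q "p + q"]
      \<rr>(2) lie_subalgebra_algebra_derivations by (auto simp: lie_solvable_def)
  then have "X (p + q) \<subseteq> ?N"
    using complex_vector.subspace_0[OF subN]
    by (auto simp: X_def clinear_zero[OF clinear_tensor_endo(1)] clinear_zero[OF clinear_tensor_endo(2)])
  then have "derived_series (p + q) I \<subseteq> ?N"
    using derI[of "p + q"] complex_vector.span_minimal[OF _ subN] by blast
  moreover obtain m where "derived_series m ?N \<subseteq> {0}"
    using lowering_solvable[OF fd center_h] .
  ultimately show ?thesis
    by (rule derived_series_into_solvable[OF I])
qed

theorem theorem1:
  fixes S \<JJ> :: "'a::complex_comm_algebra set"
    and \<ss> \<rr> :: "'g::lie_algebra endo set"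
  assumes "finite_dim TYPE('a)"
    and "\<JJ> = jacobson_radical (UNIV :: 'a set)"
    and "semisimple_subalgebra S"
    and "S + \<JJ> = UNIV" and "S \<inter> \<JJ> = {0}"
    and "finite_dim TYPE('g)"
    and "(lie_center :: 'g set) \<subseteq> lie_product UNIV UNIV"
    and "levi_decomposition (lie_derivations :: 'g endo set) \<ss> \<rr>"
    and "lie_solvable (algebra_derivations :: 'a endo set)"
  shows "is_lie_radical
      (tensor_maps \<ss> (mult_endo ` \<JJ>) + tensor_maps \<rr> (range mult_endo)
        + tensor_maps centroid algebra_derivations + tensor_maps central_homs UNIV)
      (lie_derivations :: ('g, 'a) tensor endo set)
    \<and> tensor_maps \<ss> (mult_endo ` S) \<subseteq> (lie_derivations :: ('g, 'a) tensor endo set)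
    \<and> lie_semisimple (tensor_maps \<ss> (mult_endo ` S))"
proof -
  let ?I = "tensor_maps \<ss> (mult_endo ` \<JJ>) + tensor_maps \<rr> (range mult_endo)
        + tensor_maps centroid algebra_derivations + tensor_maps central_homs UNIV :: ('g, 'a) tensor endo set"
  let ?L = "lie_derivations :: ('g, 'a) tensor endo set"
  let ?P = "tensor_maps \<ss> (mult_endo ` S)"
  have \<rr>: "lie_ideal \<rr> lie_derivations" "lie_solvable \<rr>" "\<rr> \<subseteq> lie_derivations"
    and \<ss>: "lie_semisimple \<ss>" "\<ss> \<subseteq> lie_derivations" "csubspace \<ss>" and sum: "\<ss> + \<rr> = lie_derivations"
    using assms(8) by (auto simp: levi_decomposition_def is_lie_radical_def lie_semisimple_def
        lie_subalgebra_def lie_ideal_def)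
  have I: "lie_ideal ?I ?L"
    unfolding assms(2) by (rule lie_ideal_current[OF assms(1) \<rr>(1) sum \<ss>(3)])
  have Is: "lie_solvable ?I"
    using lie_solvable_current[OF assms(1,6,7) \<ss>(2) \<rr>(3,2) assms(9)] lie_subalgebra_ideal[OF I]
    unfolding assms(2) by blast
  have PL: "?P \<subseteq> ?L"
    using \<ss>(2) tensor_endo_derivation by (intro tensor_maps_minimal csubspace_derivations) blast
  have P: "lie_semisimple ?P"
    by (rule lie_semisimple_tensor[OF assms(1) _ assms(5)[unfolded assms(2)] \<ss>(1)])
      (use assms(3) in \<open>simp add: semisimple_subalgebra_def\<close>)
  note sub = csubspace_tensor_maps csubspace_plus
  have subPI: "csubspace (?P + ?I)"
    by (intro sub)
  have incl: "?P \<subseteq> ?P + ?I" "?I \<subseteq> ?P + ?I" "tensor_maps \<ss> (mult_endo ` \<JJ>) \<subseteq> ?I"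
      "tensor_maps \<rr> (range mult_endo) \<subseteq> ?I" "tensor_maps centroid algebra_derivations \<subseteq> ?I"
      "tensor_maps central_homs UNIV \<subseteq> ?I"
    by (meson sub subset_set_plus order_trans)+
  \<comment> \<open>Of the three summands of Der(h), this is the one to be split: with D = x + y
    along \<ss> + \<rr> and a = s + j along S + \<JJ>, D \<otimes> a is x \<otimes> s plus x
    \<otimes> j + y \<otimes> a.\<close>
  have "tensor_maps lie_derivations (range mult_endo) \<subseteq> ?P + ?I"
  proof (rule tensor_maps_minimal[OF subPI])
    fix D :: "'g endo" and f :: "'a endo" assume D: "D \<in> lie_derivations" and "f \<in> range mult_endo"
    then obtain a where f: "f = mult_endo a" by auto
    have "a \<in> S + \<JJ>" by (simp add: assms(4))
    then obtain s j where a: "a = s + j" "s \<in> S" "j \<in> \<JJ>" by (rule set_plus_elim)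
    obtain x y where xy: "D = x + y" "x \<in> \<ss>" "y \<in> \<rr>"
      using D unfolding sum[symmetric] by (rule set_plus_elim)
    have "tensor_endo D f = tensor_endo x (mult_endo s) + (tensor_endo x (mult_endo j) + tensor_endo y f)"
      by (simp add: f xy(1) a(1) clinear_add[OF clinear_mult_endo] clinear_add[OF clinear_tensor_endo(1)]
          clinear_add[OF clinear_tensor_endo(2)] algebra_simps)
    also have "tensor_endo x (mult_endo s) + (tensor_endo x (mult_endo j) + tensor_endo y f) \<in> ?P + ?I"
    proof (rule set_plus_intro)
      show "tensor_endo x (mult_endo s) \<in> ?P"
        using xy a by (intro tensor_endo_in_maps imageI)
      have "tensor_endo x (mult_endo j) \<in> ?I"
        using incl(3) tensor_endo_in_maps[OF xy(2) imageI[OF a(3)]] by (rule subsetD)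
      moreover have "tensor_endo y f \<in> ?I"
        using incl(4) tensor_endo_in_maps[OF xy(3) rangeI] unfolding f by (rule subsetD)
      ultimately show "tensor_endo x (mult_endo j) + tensor_endo y f \<in> ?I"
        by (intro complex_vector.subspace_add sub)
    qed
    finally show "tensor_endo D f \<in> ?P + ?I" .
  qed
  then have "?L \<subseteq> ?P + ?I"
    using tensor_derivations[OF assms(1), where 'g = 'g]
      set_plus_subset[OF subPI set_plus_subset[OF subPI]] incl(2,5,6)
    by (meson order_trans subsetD subsetI)
  then show ?thesis
    using is_lie_radical_complement[OF lie_subalgebra_derivations I Is P PL] PL P by blast
qed

end
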